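(* Let $\gamma \subset \mathbb{R}^3$ be a closed plane or spherical curve of length $L$, parametrized by arc length $s \in [0,L]$. Put $c=0$ if $\gamma$ lies in a plane and $c=1$ if $\gamma$ lies on the unit sphere $S^2$, let $\kappa_g$ be the (geodesic) curvature of $\gamma$ in the plane, respectively in $S^2$, and denote by $\kappa^2 = c + \kappa_g^2$ the square of the curvature of $\gamma$ in $\mathbb{R}^3$. Suppose that the spin structure induced on $\gamma$ is non-trivial, i.e., that the tangent vector field of $\gamma$ has an odd rotation number. Then $$\frac{4\pi^2}{L^2} \le \mu_1\left(-4\frac{d^2}{ds^2} + \kappa^2(s)\right),$$ where $\mu_1$ is the first eigenvalue of the periodic Sturm-Liouville operator $-4\frac{d^2}{ds^2}+\kappa^2(s)$ on the interval $[0,L]$. Moreover, equality occurs if and only if the curvature $\kappa$ is constant.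
   Context: Curves are smooth, closed and regular (immersed). The first eigenvalue $\mu_1$ is the smallest eigenvalue of $-4\frac{d^2}{ds^2}+\kappa^2(s)$ acting on $L$-periodic functions of $s$. The induced spin structure on $\gamma$ is the one induced by the (unique) spin structure of the two-dimensional space form $X^2(c)$ containing $\gamma$, where $X^2(0)=\mathbb{R}^2$ and $X^2(1)=S^2$ is the unit sphere. A spin structure on a closed curve is called non-trivial if the spinor fields correspond to antiperiodic functions on $[0,L]$ (so that the square of the Dirac operator has eigenvalues $\frac{4\pi^2}{L^2}(k+\frac12)^2$, $k \in \mathbb{Z}$). For a plane curve this means that the rotation number of the tangent vector is odd. For a curve on $S^2$ only the parity of the rotation number is meaningful; it can be computed after stereographic projection from a point not on $\gamma$, and it is odd exactly when the loop in $SO(3)$ given by the moving frame (unit tangent, unit normal in $S^2$, position vector) is not null-homotopic.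
   Formalization: "Constant curvature implies equality" is stated only for curves traversed once (L is the least period): a circle of radius r covered 3 times has odd rotation number and constant curvature, but μ₁ = 1/r² > 1/(9r²) = 4π²/L². The inequality and "equality implies constant" hold for all curves. *)

theory Defs
  imports "HOL-Complex_Analysis.Complex_Analysis"
begin

definition vderiv :: "(real \<Rightarrow> 'a::real_normed_vector) \<Rightarrow> real \<Rightarrow> 'a" where
  "vderiv f = (\<lambda>s. vector_derivative f (at s))"

definition smooth :: "(real \<Rightarrow> 'a::real_normed_vector) \<Rightarrow> bool" where
  "smooth f \<longleftrightarrow> (\<forall>k s. (vderiv ^^ k) f differentiable at s)"

definition periodic :: "real \<Rightarrow> (real \<Rightarrow> 'a) \<Rightarrow> bool" where
  "periodic L f \<longleftrightarrow> (\<forall>s. f (s + L) = f s)"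


(* Closed curves are L-periodic maps on the whole line. L need not be the least period, so
   multiply covered curves are included; their length counts every covering. *)

definition closed_arclength_curve :: "real \<Rightarrow> (real \<Rightarrow> real^3) \<Rightarrow> bool" where
  "closed_arclength_curve L \<gamma> \<longleftrightarrow>
     L > 0 \<and> smooth \<gamma> \<and> periodic L \<gamma> \<and> (\<forall>s. norm (vderiv \<gamma> s) = 1)"

definition traversed_once :: "real \<Rightarrow> (real \<Rightarrow> real^3) \<Rightarrow> bool" where
  "traversed_once L \<gamma> \<longleftrightarrow> (\<forall>p. 0 < p \<and> p < L \<longrightarrow> \<not> periodic p \<gamma>)"


(* The two-dimensional space form containing the curve: the affine plane {x. n . x = d}
   with unit normal n, or the unit sphere centred at the origin. *)

datatype space_form = Plane "real^3" real | Unit_Sphere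

fun lies_on :: "(real \<Rightarrow> real^3) \<Rightarrow> space_form \<Rightarrow> bool" where
  "lies_on \<gamma> (Plane n d) \<longleftrightarrow> norm n = 1 \<and> (\<forall>s. n \<bullet> \<gamma> s = d)"
| "lies_on \<gamma> Unit_Sphere \<longleftrightarrow> (\<forall>s. \<gamma> s \<in> sphere 0 1)"

fun sectional_curvature :: "space_form \<Rightarrow> real" where
  "sectional_curvature (Plane n d) = 0"
| "sectional_curvature Unit_Sphere = 1"

fun unit_normal :: "space_form \<Rightarrow> real^3 \<Rightarrow> real^3" where
  "unit_normal (Plane n d) x = n"
| "unit_normal Unit_Sphere x = x"

(* The unit normal of the curve inside the surface, so that tangent, conormal and surface
   normal form a positively oriented orthonormal frame. *)

definition conormal :: "space_form \<Rightarrow> (real \<Rightarrow> real^3) \<Rightarrow> real \<Rightarrow> real^3" where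
  "conormal X \<gamma> s = cross3 (unit_normal X (\<gamma> s)) (vderiv \<gamma> s)"

definition geodesic_curvature :: "space_form \<Rightarrow> (real \<Rightarrow> real^3) \<Rightarrow> real \<Rightarrow> real" where
  "geodesic_curvature X \<gamma> s = vderiv (vderiv \<gamma>) s \<bullet> conormal X \<gamma> s"

definition curvature :: "space_form \<Rightarrow> (real \<Rightarrow> real^3) \<Rightarrow> real \<Rightarrow> real" where
  "curvature X \<gamma> s = sqrt (sectional_curvature X + (geodesic_curvature X \<gamma> s)\<^sup>2)"


(* Rotation number of the tangent of a curve in a plane with unit normal n, measured in the
   orthonormal basis (e, n x e) of the plane; it does not depend on the choice of e. *)

definition rotation_number :: "real^3 \<Rightarrow> real^3 \<Rightarrow> real \<Rightarrow> (real \<Rightarrow> real^3) \<Rightarrow> complex" where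
  "rotation_number n e L \<gamma> =
     winding_number (\<lambda>t. Complex (vderiv \<gamma> (L * t) \<bullet> e) (vderiv \<gamma> (L * t) \<bullet> cross3 n e)) 0"

(* The frame (tangent, conormal, position) of a curve on the sphere, as the rows of a matrix. *)

definition frame_loop :: "real \<Rightarrow> (real \<Rightarrow> real^3) \<Rightarrow> real \<Rightarrow> real^3^3" where
  "frame_loop L \<gamma> t =
     vector [vderiv \<gamma> (L * t), conormal Unit_Sphere \<gamma> (L * t), \<gamma> (L * t)]"

(* On the sphere only the parity of the rotation number makes sense. It is odd iff the frame
   loop is not null-homotopic in SO(3), i.e. iff its lift to Spin(3) is antiperiodic. *)

fun nontrivial_spin_structure :: "space_form \<Rightarrow> real \<Rightarrow> (real \<Rightarrow> real^3) \<Rightarrow> bool" where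
  "nontrivial_spin_structure (Plane n d) L \<gamma> \<longleftrightarrow>
     (\<exists>e k::int. norm e = 1 \<and> e \<bullet> n = 0 \<and> odd k \<and> rotation_number n e L \<gamma> = of_int k)"
| "nontrivial_spin_structure Unit_Sphere L \<gamma> \<longleftrightarrow>
     \<not> (\<exists>A. homotopic_loops {Q. rotation_matrix Q} (frame_loop L \<gamma>) (linepath A A))"


definition sturm_liouville :: "(real \<Rightarrow> real) \<Rightarrow> (real \<Rightarrow> real) \<Rightarrow> real \<Rightarrow> real" where
  "sturm_liouville q u s = - 4 * vderiv (vderiv u) s + q s * u s"

(* The operator is symmetric with real coefficients, so real eigenvalues with real
   eigenfunctions are all of them; for smooth q every eigenfunction is smooth. *)

definition periodic_eigenvalue :: "real \<Rightarrow> (real \<Rightarrow> real) \<Rightarrow> real \<Rightarrow> bool" where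
  "periodic_eigenvalue L q \<mu> \<longleftrightarrow>
     (\<exists>u. smooth u \<and> periodic L u \<and> (\<exists>s. u s \<noteq> 0) \<and>
          (\<forall>s. sturm_liouville q u s = \<mu> * u s))"

definition first_eigenvalue :: "real \<Rightarrow> (real \<Rightarrow> real) \<Rightarrow> real \<Rightarrow> bool" where
  "first_eigenvalue L q \<mu> \<longleftrightarrow>
     periodic_eigenvalue L q \<mu> \<and> (\<forall>\<nu>. periodic_eigenvalue L q \<nu> \<longrightarrow> \<mu> \<le> \<nu>)"

end

theory Submission
  imports Defs
begin

text \<open>
  The lift of the moving frame to the spin group gives a spinor \<open>q\<close> along the curve with \<open>|q| = 1\<close> and
  \<open>|q'| = \<kappa>/2\<close>, and the spin structure is non-trivial exactly when \<open>q(s + L) = - q(s)\<close>. If \<open>u\<close> is a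
  periodic eigenfunction, then \<open>\<psi> = u q\<close> is antiperiodic and, as \<open>q'\<close> is orthogonal to \<open>q\<close>,
  \<open>\<integral> |\<psi>'|\<^sup>2 = \<integral> u'\<^sup>2 + \<kappa>\<^sup>2 u\<^sup>2 / 4 = \<mu>/4 \<integral> |\<psi>|\<^sup>2\<close>. Wirtinger's inequality for antiperiodic functions,
  \<open>\<integral> |\<psi>'|\<^sup>2 \<ge> (\<pi>/L)\<^sup>2 \<integral> |\<psi>|\<^sup>2\<close>, gives the bound.

  In the equality case \<open>\<psi> = A cos(\<pi>s/L) + B sin(\<pi>s/L)\<close>, so \<open>\<langle>J\<psi>, \<psi>'\<rangle>\<close> is constant for each skew \<open>J\<close>. On the
  sphere two such quantities are \<open>u\<^sup>2/2\<close> and \<open>u\<^sup>2\<kappa>\<^sub>g/2\<close>, whence \<open>\<kappa>\<^sub>g\<close> is constant. In the plane only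
  \<open>u\<^sup>2\<kappa>\<^sub>g/2\<close> is available, and constancy of \<open>u\<^sup>2\<close> follows from the closedness of the curve. Conversely,
  a curve of constant curvature \<open>\<kappa>\<close> has period \<open>2\<pi>/\<kappa>\<close>, and constants are eigenfunctions for \<open>\<kappa>\<^sup>2\<close>.
\<close>

section \<open>Antiderivatives and linear differential equations\<close>

lemma has_vector_derivative_imp_continuous_on:
  assumes "\<And>s. (f has_vector_derivative f' s) (at s)"
  shows "continuous_on S f"
  by (rule continuous_at_imp_continuous_on) (simp add: assms[THEN has_vector_derivative_continuous])

lemma has_real_derivative_imp_continuous_on:
  assumes "\<And>s. (f has_real_derivative f' s) (at s)"
  shows "continuous_on S f"
  by (rule continuous_at_imp_continuous_on) (simp add: assms[THEN DERIV_isCont])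

lemma antiderivative_exists:
  fixes f :: "real \<Rightarrow> 'a::banach"
  assumes "continuous_on UNIV f"
  obtains F where "F 0 = 0" "\<And>s. (F has_vector_derivative f s) (at s)"
proof -
  \<comment> \<open>One of the two integrals always runs over an empty or degenerate interval, so
    \<open>F s\<close> is the oriented integral from 0 to \<open>s\<close>.\<close>
  define F where "F s = integral {0..s} f - integral {s..0} f" for s :: real
  have int: "f integrable_on {a..b}" for a b
    using assms continuous_on_subset integrable_continuous_real by blast
  have "(F has_vector_derivative f s) (at s)" for s
  proof -
    \<comment> \<open>The extra 1 puts \<open>s\<close> in the interior of [-R, R], where
      \<open>F\<close> is an ordinary indefinite integral up to a constant.\<close>
    define R where "R = \<bar>s\<bar> + 1"
    have F: "F x = integral {-R..x} f - integral {-R..0} f" if "x \<in> {-R<..<R}" for x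
    proof (cases "0 \<le> x")
      case True
      have "integral {x..0} f = 0" using True by (cases "x = 0") auto
      with that True Henstock_Kurzweil_Integration.integral_combine[OF _ True int, of "-R"]
      show ?thesis by (auto simp: F_def R_def algebra_simps)
    next
      case False
      with that Henstock_Kurzweil_Integration.integral_combine[of "-R" x 0 f] int
      show ?thesis by (auto simp: F_def R_def algebra_simps)
    qed
    have s: "s \<in> {-R<..<R}" by (auto simp: R_def)
    have "((\<lambda>x. integral {-R..x} f) has_vector_derivative f s) (at s within {-R..R})"
      by (rule integral_has_vector_derivative)
        (use s assms in \<open>auto intro: continuous_on_subset\<close>)
    then have "((\<lambda>x. integral {-R..x} f) has_vector_derivative f s) (at s)"
      using s at_within_Icc_at[of "-R" s R] by auto
    from has_vector_derivative_diff[OF this has_vector_derivative_const]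
    have "((\<lambda>x. integral {-R..x} f - integral {-R..0} f) has_vector_derivative f s) (at s)"
      by simp
    then show ?thesis
      by (rule has_vector_derivative_transform_within_open[of _ _ _ "{-R<..<R}"]) (use s F in simp_all)
  qed
  moreover have "F 0 = 0" by (simp add: F_def)
  ultimately show thesis using that by blast
qed

text \<open>The mean value inequality for a majorant in \<open>\<bar>s\<bar>\<close>, obtained for
  negative \<open>s\<close> by reflection. It drives the induction that bounds the Picard terms on
  both sides of 0.\<close>

lemma norm_le_antiderivative_abs:
  fixes F :: "real \<Rightarrow> 'a::real_normed_vector"
  assumes F: "\<And>s. (F has_vector_derivative f s) (at s)" "F 0 = 0"
    and G: "\<And>s. (G has_real_derivative g s) (at s)" "G 0 = 0"
    and le: "\<And>x. \<bar>x\<bar> \<le> \<bar>s\<bar> \<Longrightarrow> norm (f x) \<le> g \<bar>x\<bar>"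
  shows "norm (F s) \<le> G \<bar>s\<bar>"
proof (cases s "0::real" rule: linorder_cases)
  case equal
  then show ?thesis using F(2) G(2) by simp
next
  case greater
  have "norm (F s - F 0) \<le> G s - G 0"
  proof (rule differentiable_bound_general)
    show "continuous_on {0..s} F"
      using F(1) by (rule has_vector_derivative_imp_continuous_on)
    show "continuous_on {0..s} G"
      using G(1) by (rule has_real_derivative_imp_continuous_on)
    show "\<And>x. 0 < x \<Longrightarrow> x < s \<Longrightarrow> norm (f x) \<le> g x"
      using le greater by (metis abs_of_pos less_eq_real_def)
  qed (use F G greater in \<open>auto simp: has_real_derivative_iff_has_vector_derivative\<close>)
  then show ?thesis using greater F(2) G(2) by simp
next
  case less
  let ?F = "\<lambda>x. F (- x)"
  have F': "(?F has_vector_derivative - f (-x)) (at x)" for x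
  proof -
    have "(uminus has_vector_derivative (-1::real)) (at x)"
      by (auto intro!: derivative_eq_intros)
    then show ?thesis
      using vector_diff_chain_at[of uminus "-1" x F "f (-x)"] F(1)[of "-x"] by (simp add: o_def)
  qed
  have "norm (?F (-s) - ?F 0) \<le> G (-s) - G 0"
  proof (rule differentiable_bound_general)
    show "continuous_on {0..-s} ?F"
      using F' by (rule has_vector_derivative_imp_continuous_on)
    show "continuous_on {0..-s} G"
      using G(1) by (rule has_real_derivative_imp_continuous_on)
    show "norm (- f (- x)) \<le> g x" if "0 < x" "x < -s" for x
      using le[of "-x"] that less by auto
  qed (use F' G less in \<open>auto simp: has_real_derivative_iff_has_vector_derivative\<close>)
  then show ?thesis using less F(2) G(2) by simp
qed

text \<open>Picard iteration written as a series: each term is the integral from 0 of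
  \<open>A\<close> applied to the previous one. On [-R, R] the terms are bounded by |y0| (M R)^n /
  n!, where M bounds the norm of \<open>A\<close>, so the series converges and may be differentiated
  term by term on every bounded interval.\<close>

theorem linear_ode_solution_exists:
  fixes A :: "real \<Rightarrow> 'a::banach \<Rightarrow>\<^sub>L 'a"
  assumes A: "continuous_on UNIV A"
  obtains y where "y 0 = y0" "\<And>s. (y has_vector_derivative A s (y s)) (at s)"
proof -
  have step: "\<exists>F. F 0 = 0 \<and> (\<forall>s. (F has_vector_derivative A s (w s)) (at s))
      \<and> continuous_on UNIV F" if "continuous_on UNIV w" for w
  proof -
    have "continuous_on UNIV (\<lambda>s. A s (w s))"
      using A that by (intro continuous_intros)
    from antiderivative_exists[OF this] obtain F
      where F: "F 0 = 0" "\<And>s. (F has_vector_derivative A s (w s)) (at s)" by blast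
    moreover from F(2) have "continuous_on UNIV F"
      by (rule has_vector_derivative_imp_continuous_on)
    ultimately show ?thesis by blast
  qed
  then obtain \<Phi> where \<Phi>: "continuous_on UNIV w \<Longrightarrow> \<Phi> w 0 = 0
      \<and> (\<forall>s. (\<Phi> w has_vector_derivative A s (w s)) (at s)) \<and> continuous_on UNIV (\<Phi> w)" for w
    by metis
  \<comment> \<open>These are the terms of the Picard series, not its partial sums; hence all but
    the first vanish at 0.\<close>
  define w where "w n = (\<Phi> ^^ n) (\<lambda>_. y0)" for n
  have wc: "continuous_on UNIV (w n)" for n
    by (induction n) (auto simp: w_def \<Phi>)
  have w0: "w 0 = (\<lambda>_. y0)" by (simp add: w_def)
  have wS: "w (Suc n) = \<Phi> (w n)" for n by (simp add: w_def)
  have wS0: "w (Suc n) 0 = 0" for n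
    using \<Phi>[OF wc] by (simp add: wS)
  have w': "(w (Suc n) has_vector_derivative A s (w n s)) (at s)" for n s
    using \<Phi>[OF wc] by (simp add: wS)
  \<comment> \<open>The derivatives of the terms. Their index is shifted by one and the constant
    first term contributes 0, which is why their sum is \<open>A\<close> applied to the whole
    series.\<close>
  define w1 where "w1 n s = (case n of 0 \<Rightarrow> 0 | Suc m \<Rightarrow> A s (w m s))" for n s
  have w1: "(w n has_vector_derivative w1 n s) (at s)" for n s
    by (cases n) (auto simp: w1_def w0 w')
  have bound: "\<exists>M\<ge>0. \<forall>s\<in>{-R..R}. norm (A s) \<le> M" for R
  proof -
    have "bounded (A ` {-R..R})"
      using A by (intro compact_imp_bounded compact_continuous_image) (auto intro: continuous_on_subset)
    then obtain M where "\<forall>x\<in>A ` {-R..R}. norm x \<le> M" by (auto simp: bounded_iff)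
    then show ?thesis by (intro exI[of _ "max M 0"]) auto
  qed
  define y where "y s = (\<Sum>n. w n s)" for s
  have y': "summable (\<lambda>n. w n s) \<and> (y has_vector_derivative A s (y s)) (at s)" for s
  proof -
    define R where "R = \<bar>s\<bar> + 1"
    obtain M where M0: "M \<ge> 0" and M: "\<And>x. \<bar>x\<bar> \<le> R \<Longrightarrow> norm (A x) \<le> M" 
      using bound[of R] by (auto simp: abs_le_iff)
    have wb: "norm (w n x) \<le> norm y0 * M ^ n * \<bar>x\<bar> ^ n / fact n" if "\<bar>x\<bar> \<le> R" for n x
      using that
    proof (induction n arbitrary: x)
      case 0
      then show ?case by (simp add: w0)
    next
      case (Suc n)
      \<comment> \<open>The bound for \<open>Suc n\<close> is the antiderivative of \<open>M\<close>
        times the bound for \<open>n\<close>.\<close>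
      let ?G = "\<lambda>x. norm y0 * M ^ Suc n * x ^ Suc n / fact (Suc n)"
      let ?g = "\<lambda>x. M * (norm y0 * M ^ n * x ^ n / fact n)"
      have G: "(?G has_real_derivative ?g x) (at x)" for x
      proof -
        have "(?G has_real_derivative (norm y0 * M ^ Suc n * (real (Suc n) * x ^ n) / fact (Suc n))) (at x)"
          by (rule derivative_eq_intros refl | simp)+
        then show ?thesis
          by (rule DERIV_cong) (unfold fact_Suc, simp add: divide_simps del: of_nat_Suc)
      qed
      have "norm (A z (w n z)) \<le> ?g \<bar>z\<bar>" if "\<bar>z\<bar> \<le> \<bar>x\<bar>" for z
      proof -
        have "norm (A z (w n z)) \<le> norm (A z) * norm (w n z)" by (rule norm_blinfun)
        also have "\<dots> \<le> ?g \<bar>z\<bar>"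
          using that Suc.prems by (intro mult_mono M Suc.IH M0) auto
        finally show ?thesis .
      qed
      from norm_le_antiderivative_abs[OF w' wS0 G _ this] show ?case by simp
    qed
    \<comment> \<open>A summable majorant of the derivatives on [-R, R]; their uniform convergence
      is what allows the series to be differentiated.\<close>
    define B where "B n = (case n of 0 \<Rightarrow> 0 | Suc m \<Rightarrow> M * (norm y0 * ((M * R) ^ m / fact m)))" for n
    have sumB: "summable B"
    proof (subst summable_Suc_iff[symmetric])
      have "summable (\<lambda>m. M * (norm y0 * ((M * R) ^ m / fact m)))"
        using summable_exp[of "M * R"] by (intro summable_mult) (simp add: field_simps)
      then show "summable (\<lambda>n. B (Suc n))" by (simp add: B_def)
    qed
    have wb': "norm (w n x) \<le> norm y0 * ((M * R) ^ n / fact n)" if "\<bar>x\<bar> \<le> R" for n x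
    proof -
      have "norm y0 * M ^ n * \<bar>x\<bar> ^ n / fact n \<le> norm y0 * M ^ n * R ^ n / fact n"
        using that M0 by (intro divide_right_mono mult_left_mono power_mono) auto
      then show ?thesis using wb[OF that, of n] by (simp add: power_mult_distrib mult.assoc)
    qed
    have w1b: "norm (w1 n x) \<le> B n" if "\<bar>x\<bar> \<le> R" for n x
    proof (cases n)
      case (Suc m)
      have "norm (A x (w m x)) \<le> norm (A x) * norm (w m x)" by (rule norm_blinfun)
      also have "\<dots> \<le> M * (norm y0 * ((M * R) ^ m / fact m))"
        using that by (intro mult_mono M wb' M0) auto
      finally show ?thesis by (simp add: Suc w1_def B_def)
    qed (simp add: w1_def B_def)
    have sumw: "summable (\<lambda>n. w n x)" if "\<bar>x\<bar> \<le> R" for x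
    proof (rule summable_comparison_test')
      show "summable (\<lambda>n. norm y0 * ((M * R) ^ n / fact n))"
        using summable_exp[of "M * R"] by (intro summable_mult) (simp add: field_simps)
    qed (use wb' that in auto)
    let ?S = "{-R<..<R}"
    have lim: "uniform_limit ?S (\<lambda>n x. \<Sum>i<n. w1 i x) (\<lambda>x. \<Sum>i. w1 i x) sequentially"
      by (rule Weierstrass_m_test[OF w1b sumB]) auto
    have "\<exists>g. \<forall>x\<in>?S. (\<lambda>n. w n x) sums g x \<and>
        (g has_derivative (\<lambda>h. h *\<^sub>R (\<Sum>i. w1 i x))) (at x within ?S)"
    proof (rule has_derivative_series)
      fix e :: real assume "e > 0"
      with lim have "\<forall>\<^sub>F n in sequentially. \<forall>x\<in>?S. norm ((\<Sum>i<n. w1 i x) - (\<Sum>i. w1 i x)) < e"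
        unfolding uniform_limit_iff dist_norm by blast
      then show "\<forall>\<^sub>F n in sequentially. \<forall>x\<in>?S. \<forall>h.
          norm ((\<Sum>i<n. h *\<^sub>R w1 i x) - h *\<^sub>R (\<Sum>i. w1 i x)) \<le> e * norm h"
      proof (rule eventually_mono, intro ballI allI)
        fix n x and h :: real
        assume "\<forall>x\<in>?S. norm ((\<Sum>i<n. w1 i x) - (\<Sum>i. w1 i x)) < e" "x \<in> ?S"
        then have "norm ((\<Sum>i<n. w1 i x) - (\<Sum>i. w1 i x)) \<le> e" by force
        then have "norm h * norm ((\<Sum>i<n. w1 i x) - (\<Sum>i. w1 i x)) \<le> norm h * e"
          by (intro mult_left_mono) auto
        then show "norm ((\<Sum>i<n. h *\<^sub>R w1 i x) - h *\<^sub>R (\<Sum>i. w1 i x)) \<le> e * norm h"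
          by (simp add: scaleR_right.sum[symmetric] scaleR_diff_right[symmetric] mult.commute)
      qed
    next
      show "0 \<in> ?S" by (auto simp: R_def)
      show "(\<lambda>n. w n 0) sums (\<Sum>n. w n 0)"
        by (rule summable_sums, rule sumw) (auto simp: R_def)
      show "(w n has_derivative (\<lambda>h. h *\<^sub>R w1 n x)) (at x within ?S)" for n x
        using w1[of n x] has_derivative_at_withinI by (auto simp: has_vector_derivative_def)
    qed auto
    then obtain g where g: "\<And>x. x \<in> ?S \<Longrightarrow> (\<lambda>n. w n x) sums g x"
      "\<And>x. x \<in> ?S \<Longrightarrow> (g has_derivative (\<lambda>h. h *\<^sub>R (\<Sum>i. w1 i x))) (at x within ?S)"
      by blast
    have s: "s \<in> ?S" by (auto simp: R_def)
    have sm: "summable (\<lambda>n. w n s)" using sumw s by auto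
    have "(\<lambda>i. A s (w i s)) sums A s (y s)"
      unfolding y_def
      using bounded_linear.sums[OF blinfun.bounded_linear_right summable_sums[OF sm]] .
    then have "(\<lambda>i. w1 (Suc i) s) sums A s (y s)" by (simp add: w1_def)
    from sums_Suc[OF this] have e: "(\<Sum>i. w1 i s) = A s (y s)"
      by (simp add: w1_def sums_iff)
    have "(g has_vector_derivative A s (y s)) (at s)"
      using g(2)[OF s] unfolding has_vector_derivative_def e
        at_within_open[OF s open_greaterThanLessThan] .
    then have "(y has_vector_derivative A s (y s)) (at s)"
      by (rule has_vector_derivative_transform_within_open[of _ _ _ ?S])
        (use s g(1) in \<open>auto simp: y_def sums_iff\<close>)
    with sm show ?thesis by blast
  qed
  have "y 0 = w 0 0"
  proof -
    have "y 0 = (\<Sum>n. w (Suc n) 0) + w 0 0"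
      unfolding y_def using suminf_split_head[of "\<lambda>n. w n 0"] y'[of 0] by simp
    then show ?thesis by (simp add: wS0)
  qed
  then show thesis using y' w0 by (intro that[of y]) auto
qed

section \<open>Wirtinger's inequality for antiperiodic functions\<close>

text \<open>The double zero of f^2 beats the simple pole of the cotangent: the product is f times a
  quotient of two difference quotients times a cosine.\<close>

lemma isCont_square_times_cot:
  fixes f :: "real \<Rightarrow> real"
  assumes f: "(f has_real_derivative D) (at a)" and fa: "f a = 0" and w: "w \<noteq> 0"
  shows "isCont (\<lambda>s. (f s)\<^sup>2 * cot (w * (s - a))) a"
proof -
  have 1: "(\<lambda>s. f s / (s - a)) \<midarrow>a\<rightarrow> D"
    using f fa by (simp add: has_field_derivative_iff)
  have "((\<lambda>s. sin (w * (s - a))) has_real_derivative w) (at a)"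
    by (auto intro!: derivative_eq_intros)
  then have 2: "(\<lambda>s. sin (w * (s - a)) / (s - a)) \<midarrow>a\<rightarrow> w"
    by (simp add: has_field_derivative_iff)
  have 3: "f \<midarrow>a\<rightarrow> 0"
    using DERIV_isCont[OF f] fa by (simp add: isCont_def)
  have 4: "(\<lambda>s. cos (w * (s - a))) \<midarrow>a\<rightarrow> 1"
    by (rule tendsto_eq_intros refl | simp)+
  have "(\<lambda>s. f s * ((f s / (s - a)) / (sin (w * (s - a)) / (s - a))) * cos (w * (s - a))) \<midarrow>a\<rightarrow> 0"
    using tendsto_mult[OF tendsto_mult[OF 3 tendsto_divide[OF 1 2 w]] 4] by simp
  moreover have "\<forall>\<^sub>F s in at a. f s * ((f s / (s - a)) / (sin (w * (s - a)) / (s - a))) * cos (w * (s - a))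
      = (f s)\<^sup>2 * cot (w * (s - a))"
    using eventually_at_ball'[of 1 a UNIV, OF zero_less_one]
    by eventually_elim (auto simp: cot_def power2_eq_square)
  ultimately have "(\<lambda>s. (f s)\<^sup>2 * cot (w * (s - a))) \<midarrow>a\<rightarrow> 0"
    by (rule Lim_transform_eventually)
  then show ?thesis by (simp add: isCont_def fa)
qed

text \<open>Jacobi's device: f'^2 - w^2 f^2 minus w times the derivative of f^2 cot(w(s - a)) is the
  square of f' - w f cot(w(s - a)). The subtracted function vanishes at both ends with f, so the
  integral is the total increase of a nondecreasing function. If it is zero, the square vanishes and
  f / sin(w(s - a)) is constant.\<close>

lemma
  fixes f :: "real \<Rightarrow> real"
  assumes L: "L > 0"
    and f: "\<And>s. (f has_real_derivative f' s) (at s)"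
    and f'c: "continuous_on UNIV f'"
    and fa: "f a = 0" and fb: "f (a + L) = 0"
  shows wirtinger_dirichlet: 
      "0 \<le> integral {a..a+L} (\<lambda>s. (f' s)\<^sup>2 - (pi / L)\<^sup>2 * (f s)\<^sup>2)" (is ?le)
    and wirtinger_dirichlet_eq:
      "integral {a..a+L} (\<lambda>s. (f' s)\<^sup>2 - (pi / L)\<^sup>2 * (f s)\<^sup>2) = 0
        \<Longrightarrow> \<exists>c. \<forall>s\<in>{a..a+L}. f s = c * sin (pi / L * (s - a))"
proof -
  define w where "w = pi / L"
  have w: "w > 0" "w \<noteq> 0" and wL: "w * L = pi" using L by (auto simp: w_def)
  define h where "h s = (f' s)\<^sup>2 - w\<^sup>2 * (f s)\<^sup>2" for s
  have fc: "continuous_on S f" for S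
    using f by (rule has_real_derivative_imp_continuous_on)
  have "continuous_on UNIV h"
    unfolding h_def by (intro continuous_intros f'c fc)
  then obtain H where H: "\<And>s. (H has_vector_derivative h s) (at s)"
    using antiderivative_exists by blast
  then have H': "(H has_real_derivative h s) (at s)" for s
    by (simp add: has_real_derivative_iff_has_vector_derivative)
  have Hc: "continuous_on S H" for S
    using H by (rule has_vector_derivative_imp_continuous_on)
  have int: "integral {a..a+L} h = H (a + L) - H a"
    using L by (intro integral_unique fundamental_theorem_of_calculus)
      (auto intro: has_vector_derivative_at_within H)
  define P where "P s = (f s)\<^sup>2 * cot (w * (s - a))" for s
  have sin0: "sin (w * (s - a)) > 0" if "a < s" "s < a + L" for s
  proof (rule sin_gt_zero)
    show "0 < w * (s - a)" using w that by simp
    have "w * (s - a) < w * L" using w that by (intro mult_strict_left_mono) auto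
    then show "w * (s - a) < pi" by (simp add: wL)
  qed
  have P': "(P has_real_derivative
      2 * f s * f' s * cot (w * (s - a)) - w * (f s)\<^sup>2 / (sin (w * (s - a)))\<^sup>2) (at s)"
    if "a < s" "s < a + L" for s
  proof -
    have "((\<lambda>s. w * (s - a)) has_real_derivative w) (at s)"
      by (auto intro!: derivative_eq_intros)
    moreover have "(cot has_real_derivative - inverse ((sin (w * (s - a)))\<^sup>2)) (at (w * (s - a)))"
      using sin0[OF that] by (intro DERIV_cot) simp
    ultimately have 1: "((\<lambda>s. cot (w * (s - a))) has_real_derivative
        - inverse ((sin (w * (s - a)))\<^sup>2) * w) (at s)"
      by (rule DERIV_chain2[rotated])
    have 2: "((\<lambda>s. (f s)\<^sup>2) has_real_derivative 2 * f s * f' s) (at s)"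
      using DERIV_power[OF f[of s], of 2] by (simp add: mult_ac)
    show ?thesis
      unfolding P_def using DERIV_mult[OF 2 1]
      by (rule DERIV_cong) (simp add: divide_inverse)
  qed
  have Q': "((\<lambda>s. H s - w * P s) has_real_derivative (f' s - w * f s * cot (w * (s - a)))\<^sup>2) (at s)"
    if "a < s" "s < a + L" for s
  proof -
    let ?S = "sin (w * (s - a))" and ?C = "cos (w * (s - a))"
    \<comment> \<open>The identity csc^2 = 1 + cot^2 completes the square.\<close>
    have "1 / ?S\<^sup>2 = 1 + (?C / ?S)\<^sup>2"
      using sin0[OF that] by (simp add: divide_simps)
    moreover have "x\<^sup>2 - w\<^sup>2 * y\<^sup>2 - w * (2 * y * x * c - w * y\<^sup>2 * r) = (x - w * y * c)\<^sup>2"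
      if "r = 1 + c\<^sup>2" for x y c r
      by (simp add: that power2_eq_square algebra_simps)
    ultimately have "h s - w * (2 * f s * f' s * cot (w * (s - a)) - w * (f s)\<^sup>2 * (1 / ?S\<^sup>2))
        = (f' s - w * f s * cot (w * (s - a)))\<^sup>2"
      unfolding h_def cot_def by blast
    then have "h s - w * (2 * f s * f' s * cot (w * (s - a)) - w * (f s)\<^sup>2 / ?S\<^sup>2)
        = (f' s - w * f s * cot (w * (s - a)))\<^sup>2"
      by simp
    moreover have "((\<lambda>s. H s - w * P s) has_real_derivative
        h s - w * (2 * f s * f' s * cot (w * (s - a)) - w * (f s)\<^sup>2 / ?S\<^sup>2)) (at s)"
      by (intro DERIV_diff H' DERIV_cmult P' that)
    ultimately show ?thesis by simp
  qed
  have "isCont P s" if "a \<le> s" "s \<le> a + L" for s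
  proof -
    consider "s = a" | "s = a + L" | "a < s" "s < a + L" using \<open>a \<le> s\<close> \<open>s \<le> a + L\<close> by linarith
    then show ?thesis
    proof cases
      case 1
      then show ?thesis
        unfolding P_def using isCont_square_times_cot[OF f fa, of w] w by simp
    next
      case 2
      \<comment> \<open>The cotangent has period pi and \<open>w * L = pi\<close>, so the right
        endpoint behaves like the left one.\<close>
      have "cot (w * (s - a)) = cot (w * (s - (a + L)))" for s
      proof -
        have "w * (s - a) = w * (s - (a + L)) + pi" using wL by (simp add: algebra_simps)
        then show ?thesis by (simp add: cot_def del: mult_minus_right)
      qed
      then show ?thesis
        unfolding P_def 2 using isCont_square_times_cot[OF f fb, of w] w by simp
    next
      case 3
      then show ?thesis using P' DERIV_isCont by blast
    qed
  qed
  then have Qc: "continuous_on {a..a+L} (\<lambda>s. H s - w * P s)"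
    by (intro continuous_intros Hc continuous_at_imp_continuous_on) auto
  have mono: "H x - w * P x \<le> H y - w * P y" if "a \<le> x" "x \<le> y" "y \<le> a + L" for x y
  proof (rule DERIV_nonneg_imp_increasing_open[OF \<open>x \<le> y\<close>])
    show "\<exists>D. ((\<lambda>s. H s - w * P s) has_real_derivative D) (at z) \<and> 0 \<le> D" if "x < z" "z < y" for z
      using Q'[of z] that \<open>a \<le> x\<close> \<open>y \<le> a + L\<close> by (intro exI conjI) auto
    show "continuous_on {x..y} (\<lambda>s. H s - w * P s)"
      using Qc by (rule continuous_on_subset) (use that in auto)
  qed
  have Pa: "P a = 0" "P (a + L) = 0" by (auto simp: P_def fa fb)
  have "0 \<le> integral {a..a+L} h"
    using mono[of a "a + L"] L by (simp add: int Pa)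
  then show ?le unfolding h_def w_def .
  assume "integral {a..a+L} (\<lambda>s. (f' s)\<^sup>2 - (pi / L)\<^sup>2 * (f s)\<^sup>2) = 0"
  then have "integral {a..a+L} h = 0" unfolding h_def w_def .
  then have Hab: "H (a + L) = H a" by (simp add: int)
  have Qconst: "H x - w * P x = H a" if "a \<le> x" "x \<le> a + L" for x
    using mono[of a x] mono[of x "a + L"] that by (simp add: Pa Hab)
  have f'eq: "f' s = w * f s * cot (w * (s - a))" if "a < s" "s < a + L" for s
  proof -
    \<comment> \<open>Between equal end values the nondecreasing function is constant, so its
      derivative, the square, is zero.\<close>
    have "((\<lambda>s. H s - w * P s) has_real_derivative 0) (at s)"
      by (rule has_field_derivative_transform_within_open[OF DERIV_const, of "{a<..<a+L}" _ "H a"])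
        (use that Qconst in auto)
    from DERIV_unique[OF this Q'[OF that]] show ?thesis by simp
  qed
  define g where "g s = f s / sin (w * (s - a))" for s
  have g': "(g has_real_derivative 0) (at s)" if "a < s" "s < a + L" for s
  proof -
    have S: "sin (w * (s - a)) \<noteq> 0" using sin0[OF that] by simp
    have "(g has_real_derivative
        (f' s * sin (w * (s - a)) - f s * (cos (w * (s - a)) * w)) / (sin (w * (s - a)))\<^sup>2) (at s)"
      unfolding g_def power2_eq_square using S
      by (intro DERIV_divide f) (auto intro!: derivative_eq_intros)
    moreover have "f' s * sin (w * (s - a)) - f s * (cos (w * (s - a)) * w) = 0"
      using S by (simp add: f'eq[OF that] cot_def)
    ultimately show ?thesis by simp
  qed
  have "f s = g (a + L / 2) * sin (w * (s - a))" if s: "s \<in> {a..a+L}" for s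
  proof (cases "s = a \<or> s = a + L")
    case True
    then show ?thesis using fa fb by (auto simp: wL)
  next
    case False
    then have s': "a < s" "s < a + L" using s by auto
    have "g s = g (a + L / 2)"
      by (rule DERIV_isconst3[of a "a + L"]) (use s' L g' in auto)
    then show ?thesis using sin0[OF s'] by (simp add: g_def[of s] divide_simps)
  qed
  then show "\<exists>c. \<forall>s\<in>{a..a+L}. f s = c * sin (pi / L * (s - a))"
    unfolding w_def by blast
qed

text \<open>The derivative of the left side with respect to \<open>a\<close> is g (a + L) - g a =
  0.\<close>

lemma integral_periodic_shift:
  fixes g :: "real \<Rightarrow> real"
  assumes L: "L \<ge> 0" and c: "continuous_on UNIV g" and per: "\<And>s. g (s + L) = g s"
  shows "integral {a..a+L} g = integral {0..L} g"
proof -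
  obtain G where G: "\<And>s. (G has_vector_derivative g s) (at s)"
    using antiderivative_exists[OF c] by blast
  have int: "integral {a..a+L} g = G (a + L) - G a" for a
    using L by (intro integral_unique fundamental_theorem_of_calculus)
      (auto intro: has_vector_derivative_at_within G)
  have G': "(G has_real_derivative g s) (at s)" for s
    using G by (simp add: has_real_derivative_iff_has_vector_derivative)
  have "((\<lambda>s. G (s + L) - G s) has_real_derivative 0) (at s)" for s
    using DERIV_diff[OF DERIV_shift[THEN iffD1, OF G'[of "s + L"]] G'[of s]] per[of s] by simp
  from DERIV_isconst_all[of "\<lambda>s. G (s + L) - G s" a 0] this int[of a] int[of 0] show ?thesis
    by simp
qed

lemma antiperiodic_shift_multiple:
  fixes f :: "real \<Rightarrow> 'a::real_vector"
  assumes "\<And>s. f (s + L) = - f s"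
  shows "f (s + of_int k * L) = (if even k then f s else - f s)"
proof (induction k rule: int_induct[where k = 0])
  case base
  then show ?case by simp
next
  case (step1 i)
  then show ?case using assms[of "s + of_int i * L"] by (simp add: algebra_simps)
next
  case (step2 i)
  then show ?case using assms[of "s + of_int (i - 1) * L"] by (simp add: algebra_simps split: if_splits)
qed

text \<open>Since \<open>f 0\<close> and \<open>f L\<close> have opposite signs, \<open>f\<close>
  has a zero \<open>a\<close>, hence also the zero \<open>a + L\<close>, and the Dirichlet case
  applies in between. The integrand is periodic, so the integral can be moved back to
  [0, L].\<close>

lemma
  fixes f :: "real \<Rightarrow> real"
  assumes L: "L > 0"
    and f: "\<And>s. (f has_real_derivative f' s) (at s)"
    and f'c: "continuous_on UNIV f'"
    and anti: "\<And>s. f (s + L) = - f s"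
  shows wirtinger_antiperiodic: 
      "0 \<le> integral {0..L} (\<lambda>s. (f' s)\<^sup>2 - (pi / L)\<^sup>2 * (f s)\<^sup>2)" (is ?le)
    and wirtinger_antiperiodic_eq:
      "integral {0..L} (\<lambda>s. (f' s)\<^sup>2 - (pi / L)\<^sup>2 * (f s)\<^sup>2) = 0
        \<Longrightarrow> \<exists>A B. \<forall>s. f s = A * cos (pi / L * s) + B * sin (pi / L * s)"
proof -
  have fc: "continuous_on S f" for S
    using f by (rule has_real_derivative_imp_continuous_on)
  have "\<exists>a. f a = 0"
  proof (cases "f 0 \<le> 0")
    case True
    then show ?thesis
      using IVT'[of f 0 0 L] anti[of 0] L fc by auto
  next
    case False
    then show ?thesis
      using IVT2'[of f L 0 0] anti[of 0] L fc by auto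
  qed
  then obtain a where a: "f a = 0" by blast
  then have aL: "f (a + L) = 0" by (simp add: anti)
  have anti': "f' (s + L) = - f' s" for s
  proof -
    have "((\<lambda>s. f (s + L)) has_real_derivative f' (s + L)) (at s)"
      using f DERIV_shift by blast
    moreover have "((\<lambda>s. f (s + L)) has_real_derivative - f' s) (at s)"
      unfolding anti by (intro DERIV_minus f)
    ultimately show ?thesis by (rule DERIV_unique)
  qed
  have shift: "integral {a..a+L} (\<lambda>s. (f' s)\<^sup>2 - (pi / L)\<^sup>2 * (f s)\<^sup>2)
      = integral {0..L} (\<lambda>s. (f' s)\<^sup>2 - (pi / L)\<^sup>2 * (f s)\<^sup>2)"
    using L by (intro integral_periodic_shift) (auto intro!: continuous_intros f'c fc simp: anti anti')
  show ?le using wirtinger_dirichlet[OF L f f'c a aL] by (simp add: shift)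
  assume "integral {0..L} (\<lambda>s. (f' s)\<^sup>2 - (pi / L)\<^sup>2 * (f s)\<^sup>2) = 0"
  with wirtinger_dirichlet_eq[OF L f f'c a aL] obtain c
    where c: "\<And>s. s \<in> {a..a+L} \<Longrightarrow> f s = c * sin (pi / L * (s - a))"
    unfolding shift by blast
  \<comment> \<open>The sine is antiperiodic with the same shift, so the difference is too;
    vanishing on one period, it vanishes everywhere.\<close>
  define g where "g s = f s - c * sin (pi / L * (s - a))" for s
  have ganti: "g (s + L) = - g s" for s
  proof -
    have "pi / L * (s + L - a) = pi / L * (s - a) + pi" using L by (simp add: field_simps)
    then show ?thesis by (simp add: g_def anti)
  qed
  have g0: "g s = 0" for s
  proof -
    \<comment> \<open>Chosen so that \<open>s - of_int k * L\<close> lies in the period starting at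
      \<open>a\<close>.\<close>
    define k where "k = \<lfloor>(s - a) / L\<rfloor>"
    have "of_int k \<le> (s - a) / L" "(s - a) / L < of_int k + 1"
      unfolding k_def by linarith+
    then have "of_int k * L \<le> s - a" "s - a < (of_int k + 1) * L"
      using L by (auto simp: pos_le_divide_eq pos_divide_less_eq)
    then have "g (s - of_int k * L) = 0"
      using c[of "s - of_int k * L"] by (simp add: g_def distrib_right)
    then show ?thesis
      using antiperiodic_shift_multiple[of g L "s - of_int k * L" k] ganti by (auto split: if_splits)
  qed
  have "f s = (- c * sin (pi / L * a)) * cos (pi / L * s) + (c * cos (pi / L * a)) * sin (pi / L * s)" for s
  proof -
    have "pi / L * (s - a) = pi / L * s - pi / L * a" by (rule right_diff_distrib)
    then have "f s = c * sin (pi / L * s - pi / L * a)" using g0[of s] by (simp only: g_def)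
    then show ?thesis unfolding sin_diff by (simp only: algebra_simps)
  qed
  then show "\<exists>A B. \<forall>s. f s = A * cos (pi / L * s) + B * sin (pi / L * s)" by blast
qed

section \<open>Eigenfunctions times unit spinors\<close>

lemma periodic_derivative:
  fixes f :: "real \<Rightarrow> 'a::real_normed_vector"
  assumes "\<And>s. (f has_vector_derivative f' s) (at s)" and "\<And>s. f (s + L) = f s"
  shows "f' (s + L) = f' s"
proof -
  have "((+) L has_vector_derivative 1) (at s)"
    using has_vector_derivative_add[OF has_vector_derivative_const[of L] has_vector_derivative_id] by simp
  then have "(f \<circ> (+) L has_vector_derivative 1 *\<^sub>R f' (s + L)) (at s)"
    by (rule vector_diff_chain_at) (use assms(1)[of "s + L"] in \<open>simp add: add.commute\<close>)
  then have "(f has_vector_derivative f' (s + L)) (at s)"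
    using assms(2) by (simp add: o_def add.commute)
  then show ?thesis
    using assms(1) by (rule vector_derivative_unique_at)
qed

text \<open>A nondecreasing function is squeezed between equal values one period apart. In the plane
  equality case this removes a remainder of constant sign.\<close>

lemma periodic_nonneg_derivative:
  fixes f :: "real \<Rightarrow> real"
  assumes L: "L > 0" and f: "\<And>s. (f has_real_derivative f' s) (at s)"
    and per: "\<And>s. f (s + L) = f s" and nonneg: "\<And>s. f' s \<ge> 0"
  shows "f' s = 0"
proof -
  have mono: "f x \<le> f y" if "x \<le> y" for x y
    by (rule DERIV_nonneg_imp_nondecreasing[OF that]) (use f nonneg in blast)
  have "f x = f (s - L / 2)" if "x \<in> {s - L / 2<..<s + L / 2}" for x
    using mono[of "s - L / 2" x] mono[of x "s + L / 2"] per[of "s - L / 2"] that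
    by (simp add: algebra_simps)
  then have "(f has_real_derivative 0) (at s)"
    by (intro has_field_derivative_transform_within_open[OF DERIV_const,
          of "{s - L / 2<..<s + L / 2}" _ "f (s - L / 2)"]) (use L in auto)
  with f show ?thesis by (rule DERIV_unique)
qed

text \<open>The common setting of both surfaces: the spinor has values in \<open>complex\<close> for
  plane curves and in \<open>complex \<times> complex\<close> for spherical ones, and
  \<open>r\<close> stands for \<kappa>^2, so that |q'| = \<kappa>/2.\<close>

locale spinor_eigenfunction =
  fixes L \<mu> :: real and q q' :: "real \<Rightarrow> 'a::euclidean_space" and r u u' u'' :: "real \<Rightarrow> real"
  assumes L: "L > 0"
    and q: "\<And>s. (q has_vector_derivative q' s) (at s)"
    and q'_cont: "continuous_on UNIV q'"
    and norm_q: "\<And>s. norm (q s) = 1"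
    and norm_q': "\<And>s. q' s \<bullet> q' s = r s / 4"
    and q_anti: "\<And>s. q (s + L) = - q s"
    and u: "\<And>s. (u has_real_derivative u' s) (at s)"
    and u': "\<And>s. (u' has_real_derivative u'' s) (at s)"
    and u_per: "\<And>s. u (s + L) = u s"
    and u_eq: "\<And>s. - 4 * u'' s + r s * u s = \<mu> * u s"
    and u_nz: "\<exists>s. u s \<noteq> 0"
begin

definition \<psi> :: "real \<Rightarrow> 'a" where "\<psi> s = u s *\<^sub>R q s"

definition \<psi>' :: "real \<Rightarrow> 'a" where "\<psi>' s = u' s *\<^sub>R q s + u s *\<^sub>R q' s"

definition \<omega> :: real where "\<omega> = pi / L"

lemma \<psi>: "(\<psi> has_vector_derivative \<psi>' s) (at s)"
  unfolding \<psi>_def \<psi>'_def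
  using has_vector_derivative_scaleR[OF u q] by (simp add: add.commute)

lemma u_cont: "continuous_on S u"
  using u by (rule has_real_derivative_imp_continuous_on)

lemma u'_cont: "continuous_on S u'"
  using u' by (rule has_real_derivative_imp_continuous_on)

lemma q_cont: "continuous_on S q"
  using q by (rule has_vector_derivative_imp_continuous_on)

lemma \<psi>_cont: "continuous_on S \<psi>"
  using \<psi> by (rule has_vector_derivative_imp_continuous_on)

lemma \<psi>'_cont: "continuous_on S \<psi>'"
  unfolding \<psi>'_def
  by (intro continuous_intros u_cont u'_cont q_cont continuous_on_subset[OF q'_cont]) auto

lemma q_inner: "q s \<bullet> q s = 1"
  using norm_q by (simp add: norm_eq_1)

lemma q_q': "q s \<bullet> q' s = 0"
proof -
  have "((\<lambda>s. q s \<bullet> q s) has_vector_derivative q s \<bullet> q' s + q' s \<bullet> q s) (at s)"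
    by (intro bounded_bilinear.has_vector_derivative[OF bounded_bilinear_inner] q)
  then have "((\<lambda>s. 1) has_vector_derivative q s \<bullet> q' s + q' s \<bullet> q s) (at s)"
    by (simp add: q_inner)
  then have "q s \<bullet> q' s + q' s \<bullet> q s = 0"
    using has_vector_derivative_const by (rule vector_derivative_unique_at)
  then show ?thesis by (simp add: inner_commute)
qed

lemma \<psi>_anti: "\<psi> (s + L) = - \<psi> s"
  by (simp add: \<psi>_def u_per q_anti)

lemma \<psi>_inner: "\<psi> s \<bullet> \<psi> s = (u s)\<^sup>2"
  by (simp add: \<psi>_def q_inner power2_eq_square)

text \<open>The mixed term drops out because \<open>q\<close> and \<open>q'\<close> are orthogonal,
  and the eigenvalue equation replaces the potential. The form is chosen because u'^2 + u u'' is the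
  derivative of u u'.\<close>

lemma \<psi>'_inner: "\<psi>' s \<bullet> \<psi>' s = (u' s)\<^sup>2 + u s * u'' s + \<mu> / 4 * (u s)\<^sup>2"
proof -
  have "\<psi>' s \<bullet> \<psi>' s = (u' s)\<^sup>2 + (u s)\<^sup>2 * (r s / 4)"
    by (simp add: \<psi>'_def inner_add_left inner_add_right q_inner q_q' norm_q' inner_commute[of "q' s" "q s"]
        power2_eq_square)
  also have "(u s)\<^sup>2 * (r s / 4) = u s * (r s * u s) / 4"
    by (simp add: power2_eq_square)
  also have "r s * u s = \<mu> * u s + 4 * u'' s" using u_eq[of s] by simp
  finally show ?thesis by (simp add: power2_eq_square field_simps)
qed

lemma component: "((\<lambda>s. \<psi> s \<bullet> b) has_real_derivative \<psi>' s \<bullet> b) (at s)"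
  unfolding has_real_derivative_iff_has_vector_derivative
  using bounded_linear.has_vector_derivative[OF bounded_linear_inner_left \<psi>] .

lemma component_energy_nonneg:
  "0 \<le> integral {0..L} (\<lambda>s. (\<psi>' s \<bullet> b)\<^sup>2 - \<omega>\<^sup>2 * (\<psi> s \<bullet> b)\<^sup>2)"
  unfolding \<omega>_def by (rule wirtinger_antiperiodic[OF L component])
    (auto intro!: continuous_intros \<psi>'_cont simp: \<psi>_anti)

text \<open>The Wirtinger defects of the coordinates add up to |\<psi>'|^2 - \<omega>^2 |\<psi>|^2,
  and the exact derivative (u u')' integrates to zero by periodicity.\<close>

lemma energy_sum:
  "(\<Sum>b\<in>Basis. integral {0..L} (\<lambda>s. (\<psi>' s \<bullet> b)\<^sup>2 - \<omega>\<^sup>2 * (\<psi> s \<bullet> b)\<^sup>2))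
    = (\<mu> / 4 - \<omega>\<^sup>2) * integral {0..L} (\<lambda>s. (u s)\<^sup>2)"
proof -
  have "(\<Sum>b\<in>Basis. integral {0..L} (\<lambda>s. (\<psi>' s \<bullet> b)\<^sup>2 - \<omega>\<^sup>2 * (\<psi> s \<bullet> b)\<^sup>2))
      = integral {0..L} (\<lambda>s. \<Sum>b\<in>Basis. (\<psi>' s \<bullet> b)\<^sup>2 - \<omega>\<^sup>2 * (\<psi> s \<bullet> b)\<^sup>2)"
    by (rule integral_sum[symmetric])
      (auto intro!: integrable_continuous_real continuous_intros \<psi>_cont \<psi>'_cont)
  also have "(\<lambda>s. \<Sum>b\<in>Basis. (\<psi>' s \<bullet> b)\<^sup>2 - \<omega>\<^sup>2 * (\<psi> s \<bullet> b)\<^sup>2)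
      = (\<lambda>s. (u s * u'' s + u' s * u' s) + (\<mu> / 4 - \<omega>\<^sup>2) * (u s)\<^sup>2)"
  proof
    fix s
    have "(\<Sum>b\<in>Basis. (\<psi>' s \<bullet> b)\<^sup>2 - \<omega>\<^sup>2 * (\<psi> s \<bullet> b)\<^sup>2) = \<psi>' s \<bullet> \<psi>' s - \<omega>\<^sup>2 * (\<psi> s \<bullet> \<psi> s)"
      unfolding euclidean_inner[of "\<psi>' s" "\<psi>' s"] euclidean_inner[of "\<psi> s" "\<psi> s"]
      by (simp add: sum_subtractf sum_distrib_left power2_eq_square)
    then show "(\<Sum>b\<in>Basis. (\<psi>' s \<bullet> b)\<^sup>2 - \<omega>\<^sup>2 * (\<psi> s \<bullet> b)\<^sup>2)
        = (u s * u'' s + u' s * u' s) + (\<mu> / 4 - \<omega>\<^sup>2) * (u s)\<^sup>2"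
      by (simp add: \<psi>'_inner \<psi>_inner power2_eq_square left_diff_distrib)
  qed
  also have "integral {0..L} \<dots> = (\<mu> / 4 - \<omega>\<^sup>2) * integral {0..L} (\<lambda>s. (u s)\<^sup>2)"
  proof -
    have "((\<lambda>s. u s * u' s) has_vector_derivative u s * u'' s + u' s * u' s) (at s)" for s
      unfolding has_real_derivative_iff_has_vector_derivative[symmetric]
      using DERIV_mult[OF u[of s] u'[of s]] by (rule DERIV_cong) simp
    then have "((\<lambda>s. u s * u'' s + u' s * u' s) has_integral u L * u' L - u 0 * u' 0) {0..L}"
      using L by (intro fundamental_theorem_of_calculus) (simp_all add: has_vector_derivative_at_within)
    moreover have "u L * u' L - u 0 * u' 0 = 0"
      using u_per[of 0] periodic_derivative[of u u' L 0] u u_per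
      by (simp add: has_real_derivative_iff_has_vector_derivative)
    ultimately have 1: "((\<lambda>s. u s * u'' s + u' s * u' s) has_integral 0) {0..L}"
      by simp
    have "(\<lambda>s. (u s)\<^sup>2) integrable_on {0..L}"
      by (intro integrable_continuous_real continuous_intros u_cont)
    from has_integral_add[OF 1 has_integral_mult_right[OF integrable_integral[OF this], of "\<mu> / 4 - \<omega>\<^sup>2"]]
    show ?thesis by (simp add: integral_unique)
  qed
  finally show ?thesis .
qed

lemma u_norm_pos: "integral {0..L} (\<lambda>s. (u s)\<^sup>2) > 0"
proof -
  obtain a where a: "u a \<noteq> 0" using u_nz by blast
  \<comment> \<open>The period is started at a point where \<open>u\<close> is nonzero, so that a
    vanishing integral is contradicted at that endpoint.\<close>
  have "integral {a..a+L} (\<lambda>s. (u s)\<^sup>2) = integral {0..L} (\<lambda>s. (u s)\<^sup>2)"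
    using L by (intro integral_periodic_shift) (auto intro!: continuous_intros u_cont simp: u_per)
  moreover have "integral {a..a+L} (\<lambda>s. (u s)\<^sup>2) \<noteq> 0"
  proof
    assume "integral {a..a+L} (\<lambda>s. (u s)\<^sup>2) = 0"
    then have "\<forall>s\<in>{a..a+L}. (u s)\<^sup>2 = 0"
      using L by (subst (asm) integral_eq_0_iff) (auto intro!: continuous_intros u_cont)
    then show False using a L by auto
  qed
  moreover have "integral {a..a+L} (\<lambda>s. (u s)\<^sup>2) \<ge> 0"
    by (intro integral_nonneg integrable_continuous_real continuous_intros u_cont) auto
  ultimately show ?thesis by linarith
qed

lemma eigenvalue_ge: "4 * pi\<^sup>2 / L\<^sup>2 \<le> \<mu>"
proof -
  have "0 \<le> (\<mu> / 4 - \<omega>\<^sup>2) * integral {0..L} (\<lambda>s. (u s)\<^sup>2)"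
    unfolding energy_sum[symmetric] by (intro sum_nonneg component_energy_nonneg)
  then have "\<omega>\<^sup>2 \<le> \<mu> / 4"
    using u_norm_pos by (simp add: zero_le_mult_iff)
  then show ?thesis by (simp add: \<omega>_def power_divide mult.commute)
qed

end

section \<open>Equality case: harmonic spinor fields\<close>

locale spinor_eigenfunction_extremal = spinor_eigenfunction +
  assumes extremal: "4 * pi\<^sup>2 / L\<^sup>2 = \<mu>"
begin

text \<open>At the extremal eigenvalue the nonnegative defects sum to zero, so every coordinate is
  extremal in Wirtinger's inequality.\<close>

lemma \<psi>_harmonic:
  obtains A B where "\<And>s. \<psi> s = cos (\<omega> * s) *\<^sub>R A + sin (\<omega> * s) *\<^sub>R B"
    "\<And>s. \<psi>' s = \<omega> *\<^sub>R (cos (\<omega> * s) *\<^sub>R B - sin (\<omega> * s) *\<^sub>R A)"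
proof -
  have "\<exists>A B. \<forall>s. \<psi> s \<bullet> b = A * cos (\<omega> * s) + B * sin (\<omega> * s)" if b: "b \<in> Basis" for b :: 'a
    unfolding \<omega>_def
  proof (rule wirtinger_antiperiodic_eq[OF L component])
    have "\<mu> / 4 - \<omega>\<^sup>2 = 0" using extremal by (simp add: \<omega>_def power_divide mult.commute)
    then have "(\<Sum>b\<in>Basis. integral {0..L} (\<lambda>s. (\<psi>' s \<bullet> b)\<^sup>2 - \<omega>\<^sup>2 * (\<psi> s \<bullet> b)\<^sup>2)) = 0"
      by (simp only: energy_sum)
    then have "integral {0..L} (\<lambda>s. (\<psi>' s \<bullet> b)\<^sup>2 - \<omega>\<^sup>2 * (\<psi> s \<bullet> b)\<^sup>2) = 0"
      by (subst (asm) sum_nonneg_eq_0_iff) (use b component_energy_nonneg in auto)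
    then show "integral {0..L} (\<lambda>s. (\<psi>' s \<bullet> b)\<^sup>2 - (pi / L)\<^sup>2 * (\<psi> s \<bullet> b)\<^sup>2) = 0"
      unfolding \<omega>_def .
  qed (auto intro!: continuous_intros \<psi>'_cont simp: \<psi>_anti)
  then obtain a b where ab: "\<And>i s. i \<in> Basis \<Longrightarrow> \<psi> s \<bullet> i = a i * cos (\<omega> * s) + b i * sin (\<omega> * s)"
    by metis
  define A B where "A = (\<Sum>i\<in>Basis. a i *\<^sub>R i)" and "B = (\<Sum>i\<in>Basis. b i *\<^sub>R i)"
  have psi: "\<psi> s = cos (\<omega> * s) *\<^sub>R A + sin (\<omega> * s) *\<^sub>R B" for s
    by (rule euclidean_eqI) (simp add: ab A_def B_def inner_add_left)
  have "((\<lambda>s. cos (\<omega> * s) *\<^sub>R A + sin (\<omega> * s) *\<^sub>R B) has_vector_derivative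
      \<omega> *\<^sub>R (cos (\<omega> * s) *\<^sub>R B - sin (\<omega> * s) *\<^sub>R A)) (at s)" for s
  proof -
    have "((\<lambda>s. cos (\<omega> * s)) has_real_derivative - \<omega> * sin (\<omega> * s)) (at s)"
      "((\<lambda>s. sin (\<omega> * s)) has_real_derivative \<omega> * cos (\<omega> * s)) (at s)"
      by (auto intro!: derivative_eq_intros)
    from has_vector_derivative_add[OF
        has_vector_derivative_scaleR[OF this(1) has_vector_derivative_const[of A]]
        has_vector_derivative_scaleR[OF this(2) has_vector_derivative_const[of B]]]
    show ?thesis by (simp add: scaleR_diff_right algebra_simps)
  qed
  then have "\<psi>' s = \<omega> *\<^sub>R (cos (\<omega> * s) *\<^sub>R B - sin (\<omega> * s) *\<^sub>R A)" for s
    using \<psi> unfolding psi[abs_def] by (rule vector_derivative_unique_at[rotated])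
  with psi show thesis using that by blast
qed

text \<open>Conservation of angular momentum in harmonic motion:
  \<open>J (\<psi> s) \<bullet> \<psi>' s\<close> is \<open>\<omega> * (J A \<bullet> B)\<close>.
  The part of \<psi>' along \<open>q\<close> does not contribute, as \<open>J\<close> is
  skew.\<close>

lemma conserved_skew:
  assumes J: "linear J" and skew: "\<And>x. J x \<bullet> x = 0"
  obtains k where "\<And>s. (u s)\<^sup>2 * (J (q s) \<bullet> q' s) = k"
proof -
  obtain A B where AB: "\<And>s. \<psi> s = cos (\<omega> * s) *\<^sub>R A + sin (\<omega> * s) *\<^sub>R B"
    "\<And>s. \<psi>' s = \<omega> *\<^sub>R (cos (\<omega> * s) *\<^sub>R B - sin (\<omega> * s) *\<^sub>R A)"
    by (rule \<psi>_harmonic) blast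
  interpret J: linear J by (rule J)
  have BA: "J B \<bullet> A = - (J A \<bullet> B)"
    using skew[of "A + B"] skew[of A] skew[of B]
    by (simp add: J.add inner_add_left inner_add_right)
  have "(u s)\<^sup>2 * (J (q s) \<bullet> q' s) = \<omega> * (J A \<bullet> B)" for s
  proof -
    have "J (\<psi> s) \<bullet> \<psi>' s = (u s)\<^sup>2 * (J (q s) \<bullet> q' s)"
      by (simp add: \<psi>_def \<psi>'_def J.scaleR inner_add_right skew power2_eq_square)
    moreover have "J (\<psi> s) \<bullet> \<psi>' s = \<omega> * ((J A \<bullet> B) * (cos (\<omega> * s) * cos (\<omega> * s) + sin (\<omega> * s) * sin (\<omega> * s)))"
      unfolding AB J.add J.scaleR
      by (simp only: inner_add_left inner_diff_right inner_scaleR_left inner_scaleR_right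
          BA skew) (simp add: algebra_simps del: sin_cos_squared_add3)
    ultimately show ?thesis by simp
  qed
  then show thesis using that by blast
qed

text \<open>At a double zero of \<open>u\<close> both \<psi> and \<psi>' vanish; undoing the
  rotation by the angle \<omega> s gives A = B = 0, so \<psi> and \<open>u\<close> vanish
  identically.\<close>

lemma zeros_simple: "u s = 0 \<Longrightarrow> u' s \<noteq> 0"
proof
  assume z: "u s = 0" "u' s = 0"
  obtain A B where AB: "\<And>s. \<psi> s = cos (\<omega> * s) *\<^sub>R A + sin (\<omega> * s) *\<^sub>R B"
    "\<And>s. \<psi>' s = \<omega> *\<^sub>R (cos (\<omega> * s) *\<^sub>R B - sin (\<omega> * s) *\<^sub>R A)"
    by (rule \<psi>_harmonic) blast
  let ?c = "cos (\<omega> * s)" and ?s = "sin (\<omega> * s)"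
  have 0: "?c *\<^sub>R A + ?s *\<^sub>R B = 0" "?c *\<^sub>R B - ?s *\<^sub>R A = 0"
    using AB[of s] z L by (auto simp: \<psi>_def \<psi>'_def \<omega>_def simp del: times_divide_eq_left)
  have cs: "?c * ?c + ?s * ?s = 1" using sin_cos_squared_add3 .
  have "?c *\<^sub>R (?c *\<^sub>R A + ?s *\<^sub>R B) - ?s *\<^sub>R (?c *\<^sub>R B - ?s *\<^sub>R A) = (?c * ?c + ?s * ?s) *\<^sub>R A"
    by (simp add: scaleR_add_left scaleR_add_right scaleR_diff_right mult.commute
        del: sin_cos_squared_add3)
  then have "A = 0" unfolding 0 cs by simp
  have "?s *\<^sub>R (?c *\<^sub>R A + ?s *\<^sub>R B) + ?c *\<^sub>R (?c *\<^sub>R B - ?s *\<^sub>R A) = (?c * ?c + ?s * ?s) *\<^sub>R B"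
    by (simp add: scaleR_add_left scaleR_add_right scaleR_diff_right mult.commute
        del: sin_cos_squared_add3)
  then have "B = 0" unfolding 0 cs by simp
  have "u t = 0" for t
    using AB(1)[of t] \<open>A = 0\<close> \<open>B = 0\<close> norm_q[of t] by (auto simp: \<psi>_def)
  then show False using u_nz by blast
qed

end

section \<open>Equality case in the plane, for a closed curve \<open>\<Gamma>\<close> with tangent
  q^2\<close>

locale plane_spinor_extremal = spinor_eigenfunction_extremal L \<mu> q q' r u u' u''
  for L \<mu> and q q' :: "real \<Rightarrow> complex" and r u u' u'' +
  fixes \<kappa> :: "real \<Rightarrow> real" and \<Gamma> :: "real \<Rightarrow> complex"
  assumes q'_eq: "\<And>s. q' s = \<i> * of_real (\<kappa> s / 2) * q s"
    and \<kappa>_cont: "continuous_on UNIV \<kappa>"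
    and \<Gamma>: "\<And>s. (\<Gamma> has_vector_derivative (q s)\<^sup>2) (at s)"
    and \<Gamma>_per: "\<And>s. \<Gamma> (s + L) = \<Gamma> s"
begin

text \<open>The skew map is multiplication by i, for which
  \<open>(\<i> * q s) \<bullet> q' s\<close> is \<open>\<kappa> s / 2\<close>.\<close>

lemma curvature_conserved:
  obtains k where "\<And>s. (u s)\<^sup>2 * \<kappa> s = k"
proof -
  have "linear ((*) \<i>)" "\<And>x. (\<i> * x) \<bullet> x = 0"
    by (auto intro: bounded_linear.linear bounded_linear_mult_right simp: inner_complex_def)
  then obtain k where k: "\<And>s. (u s)\<^sup>2 * ((\<i> * q s) \<bullet> q' s) = k"
    by (rule conserved_skew) blast
  have "(\<i> * q s) \<bullet> q' s = \<kappa> s / 2 * (q s \<bullet> q s)" for s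
    unfolding q'_eq by (simp add: inner_complex_def algebra_simps)
  then have "(u s)\<^sup>2 * (\<kappa> s / 2) = k" for s
    using k[of s] by (simp only: q_inner mult_1_right)
  then have "(u s)\<^sup>2 * \<kappa> s = 2 * k" for s by (simp add: field_simps)
  then show thesis using that by blast
qed

text \<open>The field \<psi> = \<alpha> p + \<beta> cnj p traces a possibly degenerate ellipse, and
  u^2 is constant exactly when v = \<beta> cnj \<alpha> is 0. Closedness of the curve makes
  \<open>\<Phi>\<close> periodic; its derivative is nonnegative, hence zero, so Im w vanishes
  identically. As w turns at constant speed, v = 0.\<close>

lemma modulus_const_if_nonvanishing:
  assumes nz: "\<And>s. u s \<noteq> 0"
  obtains k where "\<And>s. (u s)\<^sup>2 = k"
proof -
  obtain A B where AB: "\<And>s. \<psi> s = cos (\<omega> * s) *\<^sub>R A + sin (\<omega> * s) *\<^sub>R B"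
    by (rule \<psi>_harmonic) blast
  \<comment> \<open>The coefficients of \<psi> with respect to e^(i \<omega> s) and its
    conjugate.\<close>
  define \<alpha> \<beta> where "\<alpha> = (A - \<i> * B) / 2" and "\<beta> = (A + \<i> * B) / 2"
  define p where "p s = cis (\<omega> * s)" for s
  have p_cnj: "p s * cnj (p s) = 1" for s
    by (simp add: p_def cis_cnj cis_mult)
  have psi: "\<psi> s = \<alpha> * p s + \<beta> * cnj (p s)" for s
    unfolding AB \<alpha>_def \<beta>_def p_def
    by (simp add: complex_eq_iff field_simps)
  \<comment> \<open>Up to a constant, u^2 is twice the real part of the \<open>w\<close> built from
    this \<open>v\<close>.\<close>
  define v where "v = \<beta> * cnj \<alpha>"
  define w where "w s = v * (cnj (p s))\<^sup>2" for s
  have mod: "of_real ((u s)\<^sup>2) = \<alpha> * cnj \<alpha> + \<beta> * cnj \<beta> + cnj (w s) + w s" for s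
  proof -
    have "of_real ((u s)\<^sup>2) = \<psi> s * cnj (\<psi> s)"
      using \<psi>_inner[of s] by (simp add: complex_norm_square[symmetric] power2_norm_eq_inner)
    also have "\<dots> = (\<alpha> * cnj \<alpha> + \<beta> * cnj \<beta>) * (p s * cnj (p s)) + cnj (w s) + w s"
      unfolding psi w_def v_def by (simp add: power2_eq_square algebra_simps)
    finally show ?thesis by (simp add: p_cnj)
  qed
  \<comment> \<open>The tangent is \<open>q\<^sup>2 = \<psi> / cnj \<psi>\<close>. Comparing it with the circular motion \<open>p\<^sup>2\<close>, whose mean
      also vanishes, leaves a remainder of constant sign.\<close>
  define \<Phi> where "\<Phi> s = Re (cnj \<alpha> * cnj \<beta> * \<Gamma> s) - Re (\<alpha> * cnj \<beta> * cis (2 * \<omega> * s) / (2 * \<i> * of_real \<omega>))" for s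
  have wpos: "\<omega> > 0" using L by (simp add: \<omega>_def)
  have \<Phi>': "(\<Phi> has_real_derivative 2 * (Im (w s))\<^sup>2 / (u s)\<^sup>2) (at s)" for s
  proof -
    have "((\<lambda>s. cis (2 * \<omega> * s)) has_vector_derivative (2 * \<omega>) *\<^sub>R (\<i> * cis (2 * \<omega> * s))) (at s)"
      using wpos by (auto simp: has_vector_derivative_complex_iff intro!: derivative_eq_intros)
    from bounded_linear.has_vector_derivative[OF bounded_linear_compose[OF bounded_linear_Re
          bounded_linear_mult_right[of "\<alpha> * cnj \<beta> / (2 * \<i> * of_real \<omega>)"]] this]
    have 1: "((\<lambda>s. Re (\<alpha> * cnj \<beta> * cis (2 * \<omega> * s) / (2 * \<i> * of_real \<omega>))) has_vector_derivative
        Re (\<alpha> * cnj \<beta> * cis (2 * \<omega> * s))) (at s)"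
      using wpos by (simp add: scaleR_conv_of_real field_simps)
    have 2: "((\<lambda>s. Re (cnj \<alpha> * cnj \<beta> * \<Gamma> s)) has_vector_derivative Re (cnj \<alpha> * cnj \<beta> * (q s)\<^sup>2)) (at s)"
      by (rule bounded_linear.has_vector_derivative[OF bounded_linear_compose[OF bounded_linear_Re
          bounded_linear_mult_right[of "cnj \<alpha> * cnj \<beta>"]] \<Gamma>])
    have "(u s)\<^sup>2 * (Re (cnj \<alpha> * cnj \<beta> * (q s)\<^sup>2) - Re (\<alpha> * cnj \<beta> * cis (2 * \<omega> * s))) = 2 * (Im (w s))\<^sup>2"
    proof -
      have "of_real ((u s)\<^sup>2) * (cnj \<alpha> * cnj \<beta> * (q s)\<^sup>2 - \<alpha> * cnj \<beta> * cis (2 * \<omega> * s))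
          = cnj \<alpha> * cnj \<beta> * (\<psi> s)\<^sup>2 - \<alpha> * cnj \<beta> * (p s)\<^sup>2 * (\<psi> s * cnj (\<psi> s))"
      proof -
        have "of_real ((u s)\<^sup>2) * (q s)\<^sup>2 = (\<psi> s)\<^sup>2"
          by (simp add: \<psi>_def scaleR_conv_of_real power_mult_distrib)
        moreover have "of_real ((u s)\<^sup>2) = \<psi> s * cnj (\<psi> s)"
          using \<psi>_inner[of s] by (simp add: complex_norm_square[symmetric] power2_norm_eq_inner)
        moreover have "cis (2 * \<omega> * s) = (p s)\<^sup>2"
          by (simp add: p_def power2_eq_square cis_mult mult_ac)
        ultimately show ?thesis by (simp add: right_diff_distrib) (simp add: mult_ac)
      qed
      also have "\<dots> = (w s - cnj (w s)) * (cnj (w s) + of_real (cmod \<beta> ^ 2))"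
      proof -
        \<comment> \<open>With the conjugates treated as independent variables, the claim is a
          polynomial identity modulo \<open>x * y = 1\<close>.\<close>
        have *: "ca * cb * (a * x + b * y)\<^sup>2 - a * cb * x\<^sup>2 * ((a * x + b * y) * (ca * y + cb * x))
            = (b * ca * y\<^sup>2 - cb * a * x\<^sup>2) * (cb * a * x\<^sup>2 + b * cb)"
          if "x * y = 1" for a b ca cb x y :: complex
          using that by algebra
        show ?thesis
          using *[OF p_cnj[of s], of "cnj \<alpha>" "cnj \<beta>" \<alpha> \<beta>]
          unfolding psi w_def v_def complex_norm_square by simp
      qed
      finally have "Re (of_real ((u s)\<^sup>2) * (cnj \<alpha> * cnj \<beta> * (q s)\<^sup>2 - \<alpha> * cnj \<beta> * cis (2 * \<omega> * s)))
          = Re ((w s - cnj (w s)) * (cnj (w s) + of_real (cmod \<beta> ^ 2)))"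
        by (rule arg_cong)
      \<comment> \<open>The first factor is purely imaginary, so the real summand |\<beta>|^2 leaves
        no trace in the real part.\<close>
      also have "\<dots> = 2 * (Im (w s))\<^sup>2"
        by (simp add: power2_eq_square)
      finally show ?thesis
        by (simp only: scaleR_conv_of_real[symmetric] scaleR_complex.sel minus_complex.sel)
    qed
    then have "Re (cnj \<alpha> * cnj \<beta> * (q s)\<^sup>2) - Re (\<alpha> * cnj \<beta> * cis (2 * \<omega> * s)) = 2 * (Im (w s))\<^sup>2 / (u s)\<^sup>2"
      using nz[of s] by (simp add: eq_divide_eq mult.commute)
    with has_vector_derivative_diff[OF 2 1] show ?thesis
      unfolding \<Phi>_def has_real_derivative_iff_has_vector_derivative by simp
  qed
  have \<Phi>_per: "\<Phi> (s + L) = \<Phi> s" for s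
  proof -
    have "2 * \<omega> * (s + L) = 2 * \<omega> * s + 2 * pi" using L by (simp add: \<omega>_def field_simps)
    then have "cis (2 * \<omega> * (s + L)) = cis (2 * \<omega> * s)"
      by (simp only: cis_mult[symmetric] cis_2pi mult_1_right)
    then show ?thesis by (simp add: \<Phi>_def \<Gamma>_per)
  qed
  have "2 * (Im (w s))\<^sup>2 / (u s)\<^sup>2 = 0" for s
    by (rule periodic_nonneg_derivative[OF L \<Phi>' \<Phi>_per]) auto
  then have Im0: "Im (w s) = 0" for s using nz by simp
  \<comment> \<open>At s = 0 one has w = v, and at s = L/4 one has w = - i v; the two imaginary
    parts determine v.\<close>
  have "Im v = 0" using Im0[of 0] by (simp add: w_def p_def)
  moreover have "Re v = 0"
  proof -
    have "\<omega> * (L / 4) = pi / 4" using L by (simp add: \<omega>_def)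
    then have "(cnj (p (L / 4)))\<^sup>2 = cnj (cis (pi / 4 + pi / 4))"
      by (simp only: p_def power2_eq_square complex_cnj_mult[symmetric] cis_mult)
    also have "\<dots> = - \<i>" by simp
    finally show ?thesis using Im0[of "L / 4"] by (simp add: w_def)
  qed
  ultimately have "v = 0" by (simp add: complex_eq_iff)
  then have "(u s)\<^sup>2 = Re (\<alpha> * cnj \<alpha> + \<beta> * cnj \<beta>)" for s
    using arg_cong[OF mod[of s], of Re] by (simp add: w_def)
  then show thesis using that by blast
qed

text \<open>If the conserved k is nonzero, \<open>u\<close> has no zeros and u^2 is constant. If k =
  0, \<open>u\<close> vanishes on the open set where \<kappa> is nonzero; zeros of \<open>u\<close>
  being simple, that set is empty.\<close>

lemma curvature_constant: "\<kappa> constant_on UNIV"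
proof -
  obtain k where k: "\<And>s. (u s)\<^sup>2 * \<kappa> s = k"
    by (rule curvature_conserved) blast
  show ?thesis
  proof (cases "k = 0")
    case True
    have "\<kappa> s = 0" for s
    proof (rule ccontr)
      assume "\<kappa> s \<noteq> 0"
      moreover have "open {t. \<kappa> t \<noteq> 0}"
        using \<kappa>_cont by (intro open_Collect_neq) auto
      moreover have "u t = 0" if "\<kappa> t \<noteq> 0" for t
        using k[of t] True that by simp
      ultimately have "(u has_real_derivative 0) (at s)"
        by (intro has_field_derivative_transform_within_open[OF DERIV_const, of "{t. \<kappa> t \<noteq> 0}" _ 0]) auto
      then have "u' s = 0" using u DERIV_unique by blast
      with \<open>\<kappa> s \<noteq> 0\<close> \<open>\<And>t. \<kappa> t \<noteq> 0 \<Longrightarrow> u t = 0\<close> zeros_simple show False by blast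
    qed
    then show ?thesis by (auto simp: constant_on_def)
  next
    case False
    then have "u s \<noteq> 0" for s using k[of s] by auto
    then obtain c where "\<And>s. (u s)\<^sup>2 = c"
      by (rule modulus_const_if_nonvanishing) blast
    with k have "c * \<kappa> s = k" for s by simp
    with False have "\<kappa> s = k / c" for s by (auto simp: eq_divide_eq mult.commute)
    then show ?thesis by (auto simp: constant_on_def)
  qed
qed

end

section \<open>Curves in planes and in the sphere\<close>

lemma smooth_has_vector_derivative: "smooth f \<Longrightarrow> (f has_vector_derivative vderiv f s) (at s)"
proof -
  assume "smooth f"
  then have "(vderiv ^^ 0) f differentiable at s" unfolding smooth_def by blast
  then show ?thesis by (simp add: vderiv_def vector_derivative_works)
qed

lemma smooth_vderiv: "smooth f \<Longrightarrow> smooth (vderiv f)"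
  unfolding smooth_def by (metis funpow_swap1 comp_apply funpow_Suc_right)

lemma vderiv_const: "vderiv (\<lambda>_. c) = (\<lambda>_. 0)"
  by (simp add: vderiv_def)

lemma smooth_const: "smooth (\<lambda>_. c)"
proof -
  have "\<exists>d. (vderiv ^^ k) (\<lambda>_. c) = (\<lambda>_. d)" for k
    by (induction k) (auto simp: vderiv_const)
  then show ?thesis unfolding smooth_def by (metis differentiable_const)
qed

lemma constant_if_zero_derivative:
  fixes f :: "real \<Rightarrow> 'a::real_normed_vector"
  assumes "\<And>s. (f has_vector_derivative 0) (at s)"
  shows "f s = f t"
  using has_vector_derivative_zero_constant[of UNIV f] assms by (metis UNIV_I convex_UNIV)

lemma has_vector_derivative_inner:
  fixes f g :: "real \<Rightarrow> 'a::real_inner"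
  assumes "(f has_vector_derivative f') (at s)" "(g has_vector_derivative g') (at s)"
  shows "((\<lambda>s. f s \<bullet> g s) has_vector_derivative f s \<bullet> g' + f' \<bullet> g s) (at s)"
  using bounded_bilinear.has_vector_derivative[OF bounded_bilinear_inner assms] .

lemma has_vector_derivative_cross3:
  assumes "(f has_vector_derivative f') (at s)" "(g has_vector_derivative g') (at s)"
  shows "((\<lambda>s. cross3 (f s) (g s)) has_vector_derivative cross3 (f s) g' + cross3 f' (g s)) (at s)"
  using bounded_bilinear.has_vector_derivative[OF _ assms] bilinear_cross bilinear_conv_bounded_bilinear
  by blast

lemma constant_inner_derivative:
  fixes f g :: "real \<Rightarrow> 'a::real_inner"
  assumes "(f has_vector_derivative f') (at s)" "(g has_vector_derivative g') (at s)"
    and "\<And>s. f s \<bullet> g s = c"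
  shows "f s \<bullet> g' + f' \<bullet> g s = 0"
proof -
  have "((\<lambda>s. c) has_vector_derivative f s \<bullet> g' + f' \<bullet> g s) (at s)"
    using has_vector_derivative_inner[OF assms(1,2)] assms(3) by simp
  then show ?thesis
    using has_vector_derivative_const by (rule vector_derivative_unique_at)
qed

text \<open>For the expansion, the remainder y is orthogonal to all three frame vectors. Lagrange's
  formula makes its cross product with n = \<open>cross3 v t\<close> vanish, and |y|^2 |n|^2 is the
  sum of the squares of the cross and inner products, so y = 0.\<close>

lemma cross3_frame:
  fixes v t :: "real^3"
  assumes v: "v \<bullet> v = 1" and t: "t \<bullet> t = 1" and vt: "v \<bullet> t = 0"
  shows "cross3 v t \<bullet> cross3 v t = 1" "cross3 v (cross3 v t) = - t"
    and "x = (x \<bullet> t) *\<^sub>R t + (x \<bullet> cross3 v t) *\<^sub>R cross3 v t + (x \<bullet> v) *\<^sub>R v"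
proof -
  let ?n = "cross3 v t"
  show n: "?n \<bullet> ?n = 1"
    using norm_cross_dot[of v t] v t vt by (simp add: power_mult_distrib power2_norm_eq_inner)
  show "cross3 v ?n = - t"
    using v vt by (simp add: Lagrange inner_commute)
  define y where "y = x - ((x \<bullet> t) *\<^sub>R t + (x \<bullet> ?n) *\<^sub>R ?n + (x \<bullet> v) *\<^sub>R v)"
  have y: "y \<bullet> v = 0" "y \<bullet> t = 0" "y \<bullet> ?n = 0"
    using v t vt n unfolding y_def
    by (auto simp: inner_diff_left inner_add_left inner_commute[of t v] dot_cross_self)
  have "cross3 y ?n = 0" using y by (simp add: Lagrange)
  with norm_cross_dot[of y ?n] y n have "norm y = 0"
    by (simp add: norm_eq_sqrt_inner)
  then show "x = (x \<bullet> t) *\<^sub>R t + (x \<bullet> ?n) *\<^sub>R ?n + (x \<bullet> v) *\<^sub>R v"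
    by (simp add: y_def)
qed

text \<open>The energy |x'|^2 + k^2 |x|^2 is conserved and starts at 0.\<close>

lemma harmonic_oscillator_zero:
  fixes x :: "real \<Rightarrow> 'a::real_inner"
  assumes x: "\<And>s. (x has_vector_derivative x' s) (at s)"
    and x': "\<And>s. (x' has_vector_derivative - (k\<^sup>2) *\<^sub>R x s) (at s)"
    and k: "k \<noteq> 0" and init: "x 0 = 0" "x' 0 = 0"
  shows "x s = 0"
proof -
  define E where "E s = x' s \<bullet> x' s + k\<^sup>2 * (x s \<bullet> x s)" for s
  have "(E has_vector_derivative 0) (at s)" for s
  proof -
    have "(E has_vector_derivative (x' s \<bullet> (- (k\<^sup>2) *\<^sub>R x s) + (- (k\<^sup>2) *\<^sub>R x s) \<bullet> x' s)
        + k\<^sup>2 * (x s \<bullet> x' s + x' s \<bullet> x s)) (at s)"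
      unfolding E_def
      by (intro has_vector_derivative_add has_vector_derivative_inner x x'
          has_vector_derivative_mult_right)
    then show ?thesis by (simp add: inner_commute)
  qed
  then have "E s = E 0" by (rule constant_if_zero_derivative)
  then have "x' s \<bullet> x' s + k\<^sup>2 * (x s \<bullet> x s) = 0" by (simp add: E_def init)
  then have "k\<^sup>2 * (x s \<bullet> x s) = 0"
    by (smt (verit) inner_ge_zero mult_nonneg_nonneg zero_le_power2)
  with k show ?thesis by simp
qed

text \<open>The explicit solution with the same initial data has this period, and the difference
  from it has zero energy.\<close>

lemma harmonic_oscillator_periodic:
  fixes x :: "real \<Rightarrow> 'a::real_inner"
  assumes x: "\<And>s. (x has_vector_derivative x' s) (at s)"
    and x': "\<And>s. (x' has_vector_derivative - (k\<^sup>2) *\<^sub>R x s) (at s)"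
    and k: "k > 0"
  shows "x (s + 2 * pi / k) = x s"
proof -
  define y where "y s = x s - (cos (k * s) *\<^sub>R x 0 + (sin (k * s) / k) *\<^sub>R x' 0)" for s
  define y' where "y' s = x' s - ((- k * sin (k * s)) *\<^sub>R x 0 + cos (k * s) *\<^sub>R x' 0)" for s
  have c: "((\<lambda>s. cos (k * s)) has_real_derivative - k * sin (k * s)) (at s)"
    and s: "((\<lambda>s. sin (k * s) / k) has_real_derivative cos (k * s)) (at s)"
    and s': "((\<lambda>s. - k * sin (k * s)) has_real_derivative - (k\<^sup>2) * cos (k * s)) (at s)" for s
    using k by (auto intro!: derivative_eq_intros simp: power2_eq_square)
  have scl: "((\<lambda>s. g s *\<^sub>R v) has_vector_derivative g' *\<^sub>R v) (at s)"
    if "(g has_real_derivative g') (at s)" for g g' s and v :: 'a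
    using has_vector_derivative_scaleR[OF that has_vector_derivative_const[of v]] by simp
  have y: "(y has_vector_derivative y' s) (at s)" for s
    unfolding y_def y'_def by (intro has_vector_derivative_diff has_vector_derivative_add x scl c s)
  have y': "(y' has_vector_derivative - (k\<^sup>2) *\<^sub>R y s) (at s)" for s
  proof -
    have "(y' has_vector_derivative - (k\<^sup>2) *\<^sub>R x s
        - ((- (k\<^sup>2) * cos (k * s)) *\<^sub>R x 0 + (- k * sin (k * s)) *\<^sub>R x' 0)) (at s)"
      unfolding y'_def by (intro has_vector_derivative_diff has_vector_derivative_add x' scl c s')
    moreover have "- (k\<^sup>2) *\<^sub>R x s - ((- (k\<^sup>2) * cos (k * s)) *\<^sub>R x 0 + (- k * sin (k * s)) *\<^sub>R x' 0)
        = - (k\<^sup>2) *\<^sub>R y s"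
      using k by (simp add: y_def scaleR_diff_right scaleR_add_right power2_eq_square)
    ultimately show ?thesis by simp
  qed
  have "k \<noteq> 0" "y 0 = 0" "y' 0 = 0" using k by (simp_all add: y_def y'_def)
  then have y0: "y s = 0" for s by (rule harmonic_oscillator_zero[OF y y'])
  have x_eq: "x s = cos (k * s) *\<^sub>R x 0 + (sin (k * s) / k) *\<^sub>R x' 0" for s
    using y0[of s] unfolding y_def right_minus_eq .
  have "k * (s + 2 * pi / k) = k * s + 2 * pi" using k by (simp add: field_simps)
  then show ?thesis
    using x_eq[of "s + 2 * pi / k"] x_eq[of s]
    by (metis cos_periodic sin_periodic)
qed

section \<open>The moving frame of a curve in a plane or in the sphere\<close>

locale surface_curve =
  fixes L :: real and \<gamma> :: "real \<Rightarrow> real^3" and X :: space_form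
  assumes curve: "closed_arclength_curve L \<gamma>" and surface: "lies_on \<gamma> X"
begin

abbreviation "T \<equiv> vderiv \<gamma>"
abbreviation "N \<equiv> conormal X \<gamma>"
abbreviation "\<nu> s \<equiv> unit_normal X (\<gamma> s)"
abbreviation "\<kappa>\<^sub>g \<equiv> geodesic_curvature X \<gamma>"
abbreviation "c \<equiv> sectional_curvature X"

lemma L: "L > 0" and \<gamma>_smooth: "smooth \<gamma>" and \<gamma>_per: "\<gamma> (s + L) = \<gamma> s"
  and T_inner: "T s \<bullet> T s = 1"
  using curve by (auto simp: closed_arclength_curve_def periodic_def norm_eq_1)

lemma \<gamma>': "(\<gamma> has_vector_derivative T s) (at s)"
  using \<gamma>_smooth by (rule smooth_has_vector_derivative)

lemma T'_vderiv: "(T has_vector_derivative vderiv T s) (at s)"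
  by (intro smooth_has_vector_derivative smooth_vderiv \<gamma>_smooth)

lemma T'_cont: "continuous_on S (vderiv T)"
  using smooth_has_vector_derivative[OF smooth_vderiv[OF smooth_vderiv[OF \<gamma>_smooth]]]
  by (rule has_vector_derivative_imp_continuous_on)

lemma \<nu>_inner: "\<nu> s \<bullet> \<nu> s = 1"
  using surface by (cases X) (auto simp: norm_eq_1)

text \<open>The normal is constant in a plane and equal to the position vector on the sphere; c = 0
  or 1 covers both.\<close>

lemma \<nu>': "(\<nu> has_vector_derivative c *\<^sub>R T s) (at s)"
  using \<gamma>'[of s] by (cases X) auto

lemma \<nu>_T: "\<nu> s \<bullet> T s = 0"
proof (cases X)
  case (Plane n d)
  then have "n \<bullet> T s + 0 \<bullet> \<gamma> s = 0"
    using surface by (intro constant_inner_derivative[OF has_vector_derivative_const \<gamma>']) auto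
  then show ?thesis using Plane by simp
next
  case Unit_Sphere
  have "\<gamma> s \<bullet> T s + T s \<bullet> \<gamma> s = 0"
    by (rule constant_inner_derivative[OF \<gamma>' \<gamma>', where c = 1])
      (use surface Unit_Sphere in \<open>auto simp: norm_eq_1\<close>)
  then show ?thesis using Unit_Sphere by (simp add: inner_commute)
qed

lemma N_eq: "N s = cross3 (\<nu> s) (T s)"
  by (simp add: conormal_def)

lemmas frame = cross3_frame[OF \<nu>_inner T_inner \<nu>_T, folded N_eq]

lemma N_T: "N s \<bullet> T s = 0" and N_\<nu>: "N s \<bullet> \<nu> s = 0"
  by (simp_all add: N_eq dot_cross_self)

text \<open>Unit length removes the component along T, and differentiating the orthogonality of
  \<nu> and T yields - c along \<nu>.\<close>

lemma vderiv_T: "vderiv T s = \<kappa>\<^sub>g s *\<^sub>R N s - c *\<^sub>R \<nu> s"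
proof -
  have "T s \<bullet> vderiv T s + vderiv T s \<bullet> T s = 0"
    by (rule constant_inner_derivative[OF T'_vderiv T'_vderiv]) (rule T_inner)
  then have 1: "vderiv T s \<bullet> T s = 0" by (simp add: inner_commute)
  have "\<nu> s \<bullet> vderiv T s + (c *\<^sub>R T s) \<bullet> T s = 0"
    by (rule constant_inner_derivative[OF \<nu>' T'_vderiv]) (rule \<nu>_T)
  then have 2: "vderiv T s \<bullet> \<nu> s = - c" by (simp add: T_inner inner_commute)
  show ?thesis
    by (subst frame(3)[of "vderiv T s" s]) (simp add: 1 2 geodesic_curvature_def)
qed

lemma T': "(T has_vector_derivative \<kappa>\<^sub>g s *\<^sub>R N s - c *\<^sub>R \<nu> s) (at s)"
  using T'_vderiv[of s] unfolding vderiv_T .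

lemma N': "(N has_vector_derivative - \<kappa>\<^sub>g s *\<^sub>R T s) (at s)"
proof -
  have "((\<lambda>s. cross3 (\<nu> s) (T s)) has_vector_derivative
      cross3 (\<nu> s) (\<kappa>\<^sub>g s *\<^sub>R N s - c *\<^sub>R \<nu> s) + cross3 (c *\<^sub>R T s) (T s)) (at s)"
    by (rule has_vector_derivative_cross3[OF \<nu>' T'])
  also have "cross3 (\<nu> s) (\<kappa>\<^sub>g s *\<^sub>R N s - c *\<^sub>R \<nu> s) + cross3 (c *\<^sub>R T s) (T s) = - \<kappa>\<^sub>g s *\<^sub>R T s"
    by (simp add: Cross3.right_diff_distrib cross_mult_left cross_mult_right frame(2))
  finally show ?thesis by (simp add: N_eq[abs_def])
qed

lemma \<kappa>\<^sub>g_cont: "continuous_on S \<kappa>\<^sub>g"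
proof -
  have "continuous_on S N"
    using N' by (rule has_vector_derivative_imp_continuous_on)
  then have "continuous_on S (\<lambda>s. vderiv T s \<bullet> N s)"
    by (intro continuous_intros T'_cont)
  then show ?thesis by (simp add: geodesic_curvature_def[abs_def])
qed

lemma T_per: "T (s + L) = T s"
  using \<gamma>' \<gamma>_per by (rule periodic_derivative)

lemma \<nu>_per: "\<nu> (s + L) = \<nu> s"
  by (simp add: \<gamma>_per)

lemma N_per: "N (s + L) = N s"
  by (simp only: N_eq \<nu>_per T_per)

lemma \<kappa>\<^sub>g_per: "\<kappa>\<^sub>g (s + L) = \<kappa>\<^sub>g s"
proof -
  have "vderiv T (s + L) = vderiv T s"
    using T'_vderiv T_per by (rule periodic_derivative)
  then show ?thesis by (simp only: geodesic_curvature_def N_per)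
qed

lemma c_nonneg: "c \<ge> 0" by (cases X) auto

lemma curvature_squared: "(curvature X \<gamma> s)\<^sup>2 = c + (\<kappa>\<^sub>g s)\<^sup>2"
  using c_nonneg by (simp add: curvature_def)

lemma curvature_nonneg: "curvature X \<gamma> s \<ge> 0"
  using c_nonneg by (simp add: curvature_def)

text \<open>A constant curvature determines \<open>\<kappa>\<^sub>g\<close> up to sign; being
  continuous with finitely many values, \<open>\<kappa>\<^sub>g\<close> is constant.\<close>

lemma curvature_constant_iff: "curvature X \<gamma> constant_on UNIV \<longleftrightarrow> \<kappa>\<^sub>g constant_on UNIV"
proof
  assume "curvature X \<gamma> constant_on UNIV"
  then obtain k where "\<And>s. curvature X \<gamma> s = k" by (auto simp: constant_on_def)
  then have "(\<kappa>\<^sub>g s)\<^sup>2 = k\<^sup>2 - c" for s using curvature_squared[of s] by simp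
  then have "\<bar>\<kappa>\<^sub>g s\<bar> = sqrt (k\<^sup>2 - c)" for s
    by (metis real_sqrt_abs)
  then have "\<kappa>\<^sub>g s \<in> {sqrt (k\<^sup>2 - c), - sqrt (k\<^sup>2 - c)}" for s
    by (smt (verit) insert_iff)
  then have "range \<kappa>\<^sub>g \<subseteq> {sqrt (k\<^sup>2 - c), - sqrt (k\<^sup>2 - c)}"
    by (rule image_subsetI)
  then have "finite (range \<kappa>\<^sub>g)"
    by (rule finite_subset) simp
  then show "\<kappa>\<^sub>g constant_on UNIV"
    by (intro continuous_finite_range_constant \<kappa>\<^sub>g_cont) auto
next
  assume "\<kappa>\<^sub>g constant_on UNIV"
  then show "curvature X \<gamma> constant_on UNIV"
    by (auto simp: constant_on_def curvature_def)
qed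

text \<open>The curvature vector A = T' satisfies A' = - k^2 T, so for nonzero k the curve differs
  by a constant from - A / k^2, which oscillates with period 2 pi / k. A curve traversed once has no
  period below L, whence k \<le> 2 pi / L.\<close>

lemma constant_curvature_le:
  assumes k: "\<And>s. curvature X \<gamma> s = k" and once: "traversed_once L \<gamma>"
  shows "k\<^sup>2 \<le> 4 * pi\<^sup>2 / L\<^sup>2"
proof -
  have "curvature X \<gamma> constant_on UNIV" using k by (auto simp: constant_on_def)
  then obtain g where g: "\<And>s. \<kappa>\<^sub>g s = g"
    unfolding curvature_constant_iff by (auto simp: constant_on_def)
  have k2: "k\<^sup>2 = c + g\<^sup>2" using curvature_squared[of 0] k g by simp
  have k0: "k \<ge> 0" using curvature_nonneg k by metis
  define A where "A s = g *\<^sub>R N s - c *\<^sub>R \<nu> s" for s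
  have T': "(T has_vector_derivative A s) (at s)" for s
    using T' g by (simp add: A_def)
  have A': "(A has_vector_derivative - (k\<^sup>2) *\<^sub>R T s) (at s)" for s
  proof -
    have "(A has_vector_derivative g *\<^sub>R (- g *\<^sub>R T s) - c *\<^sub>R (c *\<^sub>R T s)) (at s)"
      unfolding A_def using N'[of s] g
      by (intro has_vector_derivative_diff bounded_linear.has_vector_derivative[OF bounded_linear_scaleR_right] \<nu>')
        simp
    \<comment> \<open>As c is 0 or 1, the coefficient c^2 + g^2 is k^2.\<close>
    moreover have "c * c = c" by (cases X) auto
    then have "g *\<^sub>R (- g *\<^sub>R T s) - c *\<^sub>R (c *\<^sub>R T s) = - (c + g\<^sup>2) *\<^sub>R T s"
      by (simp add: power2_eq_square scaleR_add_left scaleR_diff_left)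
    ultimately show ?thesis by (simp only: k2)
  qed
  show ?thesis
  proof (cases "k = 0")
    case False
    define x where "x s = (- 1 / k\<^sup>2) *\<^sub>R A s" for s
    have x: "(x has_vector_derivative T s) (at s)" for s
      using bounded_linear.has_vector_derivative[OF bounded_linear_scaleR_right A', of "- 1 / k\<^sup>2"] False
      by (simp add: x_def[abs_def])
    have "(T has_vector_derivative - (k\<^sup>2) *\<^sub>R x s) (at s)" for s
      using T'[of s] False by (simp add: x_def)
    from harmonic_oscillator_periodic[OF x this] False k0
    have x_per: "x (s + 2 * pi / k) = x s" for s by simp
    have "((\<lambda>s. \<gamma> s - x s) has_vector_derivative 0) (at s)" for s
      using has_vector_derivative_diff[OF \<gamma>' x] by simp
    then have "\<gamma> s - x s = \<gamma> t - x t" for s t by (rule constant_if_zero_derivative)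
    then have "\<gamma> (s + 2 * pi / k) = \<gamma> s" for s
      using x_per by (metis diff_add_cancel)
    moreover have "0 < 2 * pi / k" using False k0 by simp
    ultimately have "\<not> 2 * pi / k < L"
      using once unfolding traversed_once_def periodic_def by blast
    then have "k \<le> 2 * pi / L" using False k0 L by (simp add: field_simps)
    then have "k\<^sup>2 \<le> (2 * pi / L)\<^sup>2" using k0 by (intro power_mono) auto
    then show ?thesis by (simp add: power_divide power_mult_distrib)
  qed simp
qed

end

section \<open>Eigenfunctions of the periodic problem\<close>

lemma periodic_eigenvalue_const: "periodic_eigenvalue L (\<lambda>_. k) k"
  unfolding periodic_eigenvalue_def
  by (intro exI[of _ "\<lambda>_. 1"]) (simp add: smooth_const periodic_def sturm_liouville_def vderiv_const)

lemma periodic_eigenvalueE: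
  assumes "periodic_eigenvalue L r \<mu>"
  obtains u u' u'' where "\<And>s. (u has_real_derivative u' s) (at s)"
    "\<And>s. (u' has_real_derivative u'' s) (at s)" "\<And>s. u (s + L) = u s"
    "\<And>s. - 4 * u'' s + r s * u s = \<mu> * u s" "\<exists>s. u s \<noteq> 0"
proof -
  obtain u where u: "smooth u" "periodic L u" "\<exists>s. u s \<noteq> 0" "\<And>s. sturm_liouville r u s = \<mu> * u s"
    using assms unfolding periodic_eigenvalue_def by blast
  show thesis
  proof (rule that[of u "vderiv u" "vderiv (vderiv u)"])
    show "(u has_real_derivative vderiv u s) (at s)"
      "(vderiv u has_real_derivative vderiv (vderiv u) s) (at s)" for s
      unfolding has_real_derivative_iff_has_vector_derivative
      using u(1) by (auto intro: smooth_has_vector_derivative smooth_vderiv)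
  qed (use u in \<open>auto simp: periodic_def sturm_liouville_def\<close>)
qed

section \<open>The spinor of a plane curve\<close>

locale plane_curve_eigenfunction = surface_curve L \<gamma> "Plane n d"
  for L \<gamma> n d +
  fixes e :: "real^3" and k :: int and \<mu> :: real and u u' u'' :: "real \<Rightarrow> real"
  assumes e_unit: "norm e = 1" and e_n: "e \<bullet> n = 0" and k_odd: "odd k"
    and rotation: "rotation_number n e L \<gamma> = of_int k"
    and u: "\<And>s. (u has_real_derivative u' s) (at s)"
    and u': "\<And>s. (u' has_real_derivative u'' s) (at s)"
    and u_per: "\<And>s. u (s + L) = u s"
    and u_eq: "\<And>s. - 4 * u'' s + (curvature (Plane n d) \<gamma> s)\<^sup>2 * u s = \<mu> * u s"
    and u_nz: "\<exists>s. u s \<noteq> 0"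
begin

text \<open>Identifies directions in the plane with complex numbers so that the quarter turn about
  \<open>n\<close> becomes multiplication by i.\<close>

definition proj :: "real^3 \<Rightarrow> complex" where "proj x = Complex (x \<bullet> e) (x \<bullet> cross3 n e)"

lemma proj_linear: "bounded_linear proj"
proof -
  have "linear proj"
    by (rule linearI) (simp_all add: proj_def inner_add_left complex_eq_iff)
  then show ?thesis by (simp add: linear_conv_bounded_linear)
qed

lemma n_inner: "n \<bullet> n = 1" and n_T: "n \<bullet> T s = 0"
  using \<nu>_inner \<nu>_T by simp_all

lemmas e_frame = cross3_frame[OF n_inner, of e]

lemma T_expand: "T s = (T s \<bullet> e) *\<^sub>R e + (T s \<bullet> cross3 n e) *\<^sub>R cross3 n e"
  using e_frame(3)[of "T s"] e_unit e_n n_T[of s]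
  by (simp add: norm_eq_1 inner_commute)

lemma e_cross: "e \<bullet> e = 1" "cross3 n e \<bullet> cross3 n e = 1" "cross3 n e \<bullet> e = 0" "e \<bullet> cross3 n e = 0"
  "cross3 n (cross3 n e) = - e"
  using e_frame(1,2) e_unit e_n by (simp_all add: norm_eq_1 inner_commute dot_cross_self)

lemma proj_N: "proj (N s) = \<i> * proj (T s)"
proof -
  have "N s = (T s \<bullet> e) *\<^sub>R cross3 n e - (T s \<bullet> cross3 n e) *\<^sub>R e"
    unfolding N_eq by (subst T_expand) (simp add: cross_add_right cross_mult_right e_cross)
  then show ?thesis
    unfolding proj_def by (simp add: complex_eq_iff inner_diff_left e_cross)
qed

lemma proj_T_unit: "cmod (proj (T s)) = 1"
proof -
  have "T s \<bullet> T s = (T s \<bullet> e)\<^sup>2 + (T s \<bullet> cross3 n e)\<^sup>2"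
    by (subst T_expand, subst (2) T_expand)
      (simp add: inner_add_left inner_add_right e_cross power2_eq_square)
  then show ?thesis by (simp add: proj_def cmod_def T_inner)
qed

text \<open>The spinor is the unit complex number at half the tangent angle. This angle is an
  antiderivative of \<open>\<kappa>\<^sub>g\<close> and grows over a period by 2 pi times the
  rotation number, so its half grows by an odd multiple of pi and the spinor changes sign.\<close>

lemma spinor_exists:
  obtains q where "\<And>s. (q has_vector_derivative \<i> * of_real (\<kappa>\<^sub>g s / 2) * q s) (at s)"
    "\<And>s. cmod (q s) = 1" "\<And>s. q (s + L) = - q s" "\<And>s. (q s)\<^sup>2 = proj (T s)"
proof -
  obtain \<theta> where \<theta>0: "\<theta> 0 = 0" and \<theta>: "\<And>s. (\<theta> has_vector_derivative \<kappa>\<^sub>g s) (at s)"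
    using antiderivative_exists[OF \<kappa>\<^sub>g_cont] by blast
  then have \<theta>': "(\<theta> has_real_derivative \<kappa>\<^sub>g s) (at s)" for s
    by (simp add: has_real_derivative_iff_has_vector_derivative)
  \<comment> \<open>Stated for a general factor \<open>b\<close>: the value -1 unwinds the tangent,
    the value 1/2 gives the spinor.\<close>
  have cis': "((\<lambda>s. cis (a + b * \<theta> s)) has_vector_derivative \<i> * of_real (b * \<kappa>\<^sub>g s) * cis (a + b * \<theta> s)) (at s)"
    for a b s
    using \<theta>'[of s] by (auto simp: has_vector_derivative_complex_iff intro!: derivative_eq_intros)
  have Z': "((\<lambda>s. proj (T s)) has_vector_derivative \<i> * of_real (\<kappa>\<^sub>g s) * proj (T s)) (at s)" for s
    using bounded_linear.has_vector_derivative[OF proj_linear T'[of s]]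
    by (simp add: linear_scale[OF bounded_linear.linear[OF proj_linear]] proj_N)
      (simp add: scaleR_conv_of_real mult_ac)
  define \<theta>\<^sub>0 where "\<theta>\<^sub>0 = Arg (proj (T 0))"
  \<comment> \<open>Unwinding the tangent by its angle leaves the initial direction.\<close>
  have "((\<lambda>s. proj (T s) * cis (0 + - 1 * \<theta> s)) has_vector_derivative 0) (at s)" for s
    using has_vector_derivative_mult[OF Z' cis'[of 0 "- 1" s]] by (simp add: algebra_simps)
  then have "proj (T s) * cis (0 + - 1 * \<theta> s) = proj (T 0) * cis (0 + - 1 * \<theta> 0)" for s
    by (rule constant_if_zero_derivative)
  then have 1: "proj (T s) * cis (- \<theta> s) = cis \<theta>\<^sub>0" for s
    using cis_Arg[of "proj (T 0)"] proj_T_unit[of 0]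
    by (cases "proj (T 0) = 0") (simp_all add: \<theta>0 \<theta>\<^sub>0_def sgn_eq)
  have Z: "proj (T s) = cis (\<theta>\<^sub>0 + \<theta> s)" for s
  proof -
    have "proj (T s) = (proj (T s) * cis (- \<theta> s)) * cis (\<theta> s)"
      by (simp add: mult.assoc cis_mult)
    then show ?thesis by (simp only: 1 cis_mult)
  qed
  have \<theta>_cont: "continuous_on S \<theta>" for S
    using \<theta> by (rule has_vector_derivative_imp_continuous_on)
  have "path (\<lambda>t. \<i> * of_real (\<theta>\<^sub>0 + \<theta> (L * t)))"
    unfolding path_def
    by (intro continuous_intros continuous_on_compose2[OF \<theta>_cont[of UNIV]]) auto
  from winding_number_compose_exp[OF this]
  have "winding_number (\<lambda>t. proj (T (L * t))) 0 = of_real (\<theta> L / (2 * pi))"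
    by (simp add: o_def Z cis_conv_exp pathstart_def pathfinish_def \<theta>0 field_simps)
  then have "of_real (\<theta> L / (2 * pi)) = (of_real (of_int k) :: complex)"
    using rotation by (simp add: rotation_number_def proj_def)
  then have \<theta>L: "\<theta> L = 2 * pi * of_int k" by (simp only: of_real_eq_iff) (simp add: field_simps)
  \<comment> \<open>Periodicity of \<open>\<kappa>\<^sub>g\<close> makes the growth of the angle
    over a period independent of the starting point.\<close>
  have "((\<lambda>s. \<theta> (s + L) - \<theta> s) has_real_derivative 0) (at s)" for s
    using DERIV_diff[OF DERIV_shift[THEN iffD1, OF \<theta>'[of "s + L"]] \<theta>'[of s]] \<kappa>\<^sub>g_per[of s] by simp
  then have \<theta>_shift: "\<theta> (s + L) = \<theta> s + 2 * pi * of_int k" for s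
    using DERIV_isconst_all[of "\<lambda>s. \<theta> (s + L) - \<theta> s" s 0] by (simp add: \<theta>0 \<theta>L)
  define q where "q s = cis (\<theta>\<^sub>0 / 2 + 1 / 2 * \<theta> s)" for s
  show thesis
  proof (rule that[of q])
    show "(q has_vector_derivative \<i> * of_real (\<kappa>\<^sub>g s / 2) * q s) (at s)" for s
      using cis'[of "\<theta>\<^sub>0 / 2" "1 / 2" s] by (simp add: q_def[abs_def])
    show "cmod (q s) = 1" for s by (simp add: q_def)
    show "(q s)\<^sup>2 = proj (T s)" for s
      by (simp add: q_def Z power2_eq_square cis_mult)
    show "q (s + L) = - q s" for s
    proof -
      have "\<theta>\<^sub>0 / 2 + 1 / 2 * \<theta> (s + L) = (\<theta>\<^sub>0 / 2 + 1 / 2 * \<theta> s) + pi * of_int k"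
        by (simp add: \<theta>_shift)
      then have "q (s + L) = q s * cis (pi * of_int k)"
        by (simp only: q_def cis_mult)
      also have "cis (pi * of_int k) = -1"
        using k_odd by (simp add: complex_eq_iff)
      finally show ?thesis by simp
    qed
  qed
qed

lemma plane_eigenvalue_bound:
  "4 * pi\<^sup>2 / L\<^sup>2 \<le> \<mu>"
  "4 * pi\<^sup>2 / L\<^sup>2 = \<mu> \<Longrightarrow> curvature (Plane n d) \<gamma> constant_on UNIV"
proof -
  obtain q where spinor: "\<And>s. (q has_vector_derivative \<i> * of_real (\<kappa>\<^sub>g s / 2) * q s) (at s)"
    "\<And>s. cmod (q s) = 1" "\<And>s. q (s + L) = - q s" "\<And>s. (q s)\<^sup>2 = proj (T s)"
    by (rule spinor_exists) blast
  let ?q' = "\<lambda>s. \<i> * of_real (\<kappa>\<^sub>g s / 2) * q s"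
  have q_cont: "continuous_on UNIV q"
    using spinor(1) by (rule has_vector_derivative_imp_continuous_on)
  have S: "spinor_eigenfunction L \<mu> q ?q' (\<lambda>s. (curvature (Plane n d) \<gamma> s)\<^sup>2) u u' u''"
  proof
    show "?q' s \<bullet> ?q' s = (curvature (Plane n d) \<gamma> s)\<^sup>2 / 4" for s
      unfolding curvature_squared
      by (simp add: power2_norm_eq_inner[symmetric] norm_mult spinor(2) power_divide)
    show "continuous_on UNIV ?q'"
      by (intro continuous_intros q_cont \<kappa>\<^sub>g_cont) auto
  qed (use L spinor u u' u_per u_eq u_nz in auto)
  then interpret spinor_eigenfunction L \<mu> q ?q' "\<lambda>s. (curvature (Plane n d) \<gamma> s)\<^sup>2" u u' u'' .
  show "4 * pi\<^sup>2 / L\<^sup>2 \<le> \<mu>" by (rule eigenvalue_ge)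
  assume extremal: "4 * pi\<^sup>2 / L\<^sup>2 = \<mu>"
  interpret plane_spinor_extremal L \<mu> q ?q' "\<lambda>s. (curvature (Plane n d) \<gamma> s)\<^sup>2" u u' u''
    \<kappa>\<^sub>g "\<lambda>s. proj (\<gamma> s)"
  proof
    show "((\<lambda>s. proj (\<gamma> s)) has_vector_derivative (q s)\<^sup>2) (at s)" for s
      unfolding spinor(4) by (rule bounded_linear.has_vector_derivative[OF proj_linear \<gamma>'])
  qed (use extremal \<kappa>\<^sub>g_cont \<gamma>_per in auto)
  show "curvature (Plane n d) \<gamma> constant_on UNIV"
    unfolding curvature_constant_iff by (rule curvature_constant)
qed

end

section \<open>The spinor of a spherical curve\<close>

lemma vector_3_eq: "vector [x, y, z] = (\<chi> i::3. if i = 1 then x else if i = 2 then y else z)"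
  by (simp add: vec_eq_iff forall_3)

lemma continuous_on_vector_3:
  fixes f g h :: "'a::topological_space \<Rightarrow> 'b::{topological_space,zero}"
  assumes "continuous_on S f" "continuous_on S g" "continuous_on S h"
  shows "continuous_on S (\<lambda>x. vector [f x, g x, h x] :: 'b^3)"
  unfolding vector_3_eq
proof (rule continuous_on_vec_lambda)
  show "continuous_on S (\<lambda>x. if i = 1 then f x else if i = 2 then g x else h x)" for i :: 3
    using assms by (cases "i = 1"; cases "i = 2") simp_all
qed

lemma rotation_matrix_rows:
  fixes x y z :: "real^3"
  assumes "x \<bullet> x = 1" "y \<bullet> y = 1" "z \<bullet> z = 1" "x \<bullet> y = 0" "x \<bullet> z = 0" "y \<bullet> z = 0"
    and "cross3 x y \<bullet> z = 1"
  shows "rotation_matrix (vector [x, y, z])"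
proof -
  have "row 1 (vector [x, y, z] :: real^3^3) = x" "row 2 (vector [x, y, z] :: real^3^3) = y"
    "row 3 (vector [x, y, z] :: real^3^3) = z"
    by (simp_all add: row_def)
  then have "orthogonal_matrix (vector [x, y, z] :: real^3^3)"
    unfolding orthogonal_matrix_orthonormal_rows
    using assms by (simp add: forall_3 norm_eq_1 orthogonal_def inner_commute)
  moreover have "det (vector [x, y, z] :: real^3^3) = 1"
    using assms(7) cross_triple[of x y z] by (simp add: dot_cross_det[symmetric] inner_commute)
  ultimately show ?thesis by (simp add: rotation_matrix_def)
qed

text \<open>Unit quaternions \<open>a + b i + (c + d i) j\<close> are written as pairs \<open>(a + b i, c + d i)\<close>; the
  functions below are right multiplication by \<open>j\<close> and by \<open>k\<close>.\<close>

definition mult_j :: "complex \<times> complex \<Rightarrow> complex \<times> complex" where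
  "mult_j x = (- snd x, fst x)"

definition mult_k :: "complex \<times> complex \<Rightarrow> complex \<times> complex" where
  "mult_k x = (\<i> * snd x, \<i> * fst x)"

lemma bounded_linear_mult_j: "bounded_linear mult_j"
  unfolding mult_j_def[abs_def]
  by (intro bounded_linear_Pair bounded_linear_minus bounded_linear_fst bounded_linear_snd)

lemma bounded_linear_mult_k: "bounded_linear mult_k"
  unfolding mult_k_def[abs_def]
  by (intro bounded_linear_Pair bounded_linear_compose[OF bounded_linear_mult_right]
      bounded_linear_fst bounded_linear_snd)

lemma mult_j_k_inner:
  "mult_j x \<bullet> x = 0" "mult_k x \<bullet> x = 0" "mult_j x \<bullet> mult_k x = 0"
  "mult_j x \<bullet> mult_j x = x \<bullet> x" "mult_k x \<bullet> mult_k x = x \<bullet> x"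
  by (simp_all add: mult_j_def mult_k_def inner_prod_def inner_complex_def)

text \<open>Conjugation by a unit quaternion \<open>q\<close>: the coordinates of \<open>q i q\<^sup>*\<close>, \<open>q j q\<^sup>*\<close> and \<open>q k q\<^sup>*\<close>
  in an orthonormal basis \<open>x, y, z\<close>.\<close>

definition quat_rows :: "real^3 \<Rightarrow> real^3 \<Rightarrow> real^3 \<Rightarrow> complex \<times> complex \<Rightarrow> real^3^3" where
  "quat_rows x y z q = (let a = Re (fst q); b = Im (fst q); c = Re (snd q); d = Im (snd q) in vector [
     (a\<^sup>2 + b\<^sup>2 - c\<^sup>2 - d\<^sup>2) *\<^sub>R x + (2 * (b * c + a * d)) *\<^sub>R y + (2 * (b * d - a * c)) *\<^sub>R z,
     (2 * (b * c - a * d)) *\<^sub>R x + (a\<^sup>2 - b\<^sup>2 + c\<^sup>2 - d\<^sup>2) *\<^sub>R y + (2 * (c * d + a * b)) *\<^sub>R z,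
     (2 * (b * d + a * c)) *\<^sub>R x + (2 * (c * d - a * b)) *\<^sub>R y + (a\<^sup>2 - b\<^sup>2 - c\<^sup>2 + d\<^sup>2) *\<^sub>R z])"

lemma continuous_on_quat_rows: "continuous_on S (quat_rows x y z)"
  unfolding quat_rows_def[abs_def] Let_def
  by (intro continuous_on_vector_3 continuous_intros)

text \<open>The double cover of SO(3) by unit quaternions; orthonormality and orientation are
  polynomial identities modulo |q|^2 = 1.\<close>

lemma rotation_matrix_quat_rows:
  fixes x y z :: "real^3"
  assumes on: "x \<bullet> x = 1" "y \<bullet> y = 1" "z \<bullet> z = 1" "x \<bullet> y = 0" "x \<bullet> z = 0" "y \<bullet> z = 0"
    and cr: "cross3 x y = z" "cross3 y z = x" "cross3 z x = y"
    and q: "q \<bullet> q = 1"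
  shows "rotation_matrix (quat_rows x y z q)"
proof -
  obtain a b c d where q_eq: "q = (Complex a b, Complex c d)"
    by (metis complex.exhaust surj_pair)
  have h: "a\<^sup>2 + b\<^sup>2 + c\<^sup>2 + d\<^sup>2 = 1"
    using q by (simp add: q_eq inner_prod_def inner_complex_def power2_eq_square)
  have lin: "(p1 *\<^sub>R x + p2 *\<^sub>R y + p3 *\<^sub>R z) \<bullet> (r1 *\<^sub>R x + r2 *\<^sub>R y + r3 *\<^sub>R z)
      = p1 * r1 + p2 * r2 + p3 * r3" for p1 p2 p3 r1 r2 r3
    using on by (simp add: inner_add_left inner_add_right inner_commute)
  have cr': "cross3 y x = - z" "cross3 z y = - x" "cross3 x z = - y"
    using cr cross_skew by metis+
  have cro: "cross3 (p1 *\<^sub>R x + p2 *\<^sub>R y + p3 *\<^sub>R z) (r1 *\<^sub>R x + r2 *\<^sub>R y + r3 *\<^sub>R z)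
      = (p2 * r3 - p3 * r2) *\<^sub>R x + (p3 * r1 - p1 * r3) *\<^sub>R y + (p1 * r2 - p2 * r1) *\<^sub>R z"
    for p1 p2 p3 r1 r2 r3
    by (simp add: cross_add_left cross_add_right cross_mult_left cross_mult_right cr cr'
        algebra_simps)
  show ?thesis
    unfolding q_eq quat_rows_def Let_def fst_conv snd_conv complex.sel
  proof (rule rotation_matrix_rows; unfold lin cro)
    \<comment> \<open>The determinant is homogeneous of degree 6 and equals the cube of
      |q|^2.\<close>
    have "(2 * (b * c + a * d) * (2 * (c * d + a * b)) - 2 * (b * d - a * c) * (a\<^sup>2 - b\<^sup>2 + c\<^sup>2 - d\<^sup>2)) * (2 * (b * d + a * c))
        + (2 * (b * d - a * c) * (2 * (b * c - a * d)) - (a\<^sup>2 + b\<^sup>2 - c\<^sup>2 - d\<^sup>2) * (2 * (c * d + a * b))) * (2 * (c * d - a * b))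
        + ((a\<^sup>2 + b\<^sup>2 - c\<^sup>2 - d\<^sup>2) * (a\<^sup>2 - b\<^sup>2 + c\<^sup>2 - d\<^sup>2) - 2 * (b * c + a * d) * (2 * (b * c - a * d))) * (a\<^sup>2 - b\<^sup>2 - c\<^sup>2 + d\<^sup>2)
        = (a\<^sup>2 + b\<^sup>2 + c\<^sup>2 + d\<^sup>2) ^ 3"
      by (simp add: power2_eq_square power3_eq_cube algebra_simps)
    then show "(2 * (b * c + a * d) * (2 * (c * d + a * b)) - 2 * (b * d - a * c) * (a\<^sup>2 - b\<^sup>2 + c\<^sup>2 - d\<^sup>2)) * (2 * (b * d + a * c))
        + (2 * (b * d - a * c) * (2 * (b * c - a * d)) - (a\<^sup>2 + b\<^sup>2 - c\<^sup>2 - d\<^sup>2) * (2 * (c * d + a * b))) * (2 * (c * d - a * b))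
        + ((a\<^sup>2 + b\<^sup>2 - c\<^sup>2 - d\<^sup>2) * (a\<^sup>2 - b\<^sup>2 + c\<^sup>2 - d\<^sup>2) - 2 * (b * c + a * d) * (2 * (b * c - a * d))) * (a\<^sup>2 - b\<^sup>2 - c\<^sup>2 + d\<^sup>2)
        = 1"
      by (simp add: h)
    show "2 * (b * c - a * d) * (2 * (b * d + a * c)) + (a\<^sup>2 - b\<^sup>2 + c\<^sup>2 - d\<^sup>2) * (2 * (c * d - a * b))
        + 2 * (c * d + a * b) * (a\<^sup>2 - b\<^sup>2 - c\<^sup>2 + d\<^sup>2) = 0"
      by (simp add: power2_eq_square algebra_simps)
  qed (use h in algebra)+
qed

section \<open>Lift of the moving frame to unit quaternions\<close>

locale sphere_curve_eigenfunction = surface_curve L \<gamma> Unit_Sphere for L \<gamma> +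
  fixes \<mu> :: real and u u' u'' :: "real \<Rightarrow> real"
  assumes spin: "nontrivial_spin_structure Unit_Sphere L \<gamma>"
    and u: "\<And>s. (u has_real_derivative u' s) (at s)"
    and u': "\<And>s. (u' has_real_derivative u'' s) (at s)"
    and u_per: "\<And>s. u (s + L) = u s"
    and u_eq: "\<And>s. - 4 * u'' s + (curvature Unit_Sphere \<gamma> s)\<^sup>2 * u s = \<mu> * u s"
    and u_nz: "\<exists>s. u s \<noteq> 0"
begin

text \<open>Right multiplication by half of j + \<open>\<kappa>\<^sub>g\<close> k: this is the
  angular velocity of the frame, seen in the Lie algebra of the unit quaternions, when T, N and
  \<gamma> are the rotated i, j and k.\<close>

definition spin_op :: "real \<Rightarrow> complex \<times> complex \<Rightarrow> complex \<times> complex" where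
  "spin_op s x = (1 / 2) *\<^sub>R mult_j x + (\<kappa>\<^sub>g s / 2) *\<^sub>R mult_k x"

lemma spin_op_inner: "spin_op s x \<bullet> x = 0"
  by (simp add: spin_op_def inner_add_left mult_j_k_inner)

lemma spin_op_norm: "spin_op s x \<bullet> spin_op s x = (1 + (\<kappa>\<^sub>g s)\<^sup>2) / 4 * (x \<bullet> x)"
  by (simp add: spin_op_def inner_add_left inner_add_right mult_j_k_inner
      inner_commute[of "mult_k x" "mult_j x"] power2_eq_square field_simps)

lemma spin_op_linear: "bounded_linear (spin_op s)"
  unfolding spin_op_def[abs_def]
  by (intro bounded_linear_add bounded_linear_compose[OF bounded_linear_scaleR_right]
      bounded_linear_mult_j bounded_linear_mult_k)

text \<open>The operator is skew. Since the equation is linear, this also gives uniqueness: a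
  solution with one zero vanishes identically.\<close>

lemma spin_solution_norm:
  assumes "\<And>s. (y has_vector_derivative spin_op s (y s)) (at s)"
  shows "y s \<bullet> y s = y t \<bullet> y t"
proof -
  have "((\<lambda>s. y s \<bullet> y s) has_vector_derivative y s \<bullet> spin_op s (y s) + spin_op s (y s) \<bullet> y s) (at s)" for s
    using assms assms by (rule has_vector_derivative_inner)
  then have "((\<lambda>s. y s \<bullet> y s) has_vector_derivative 0) (at s)" for s
    by (simp add: spin_op_inner inner_commute[of "y s" "spin_op s (y s)" for s])
  then show ?thesis by (rule constant_if_zero_derivative)
qed

lemma spin_solution_exists:
  obtains q where "q 0 = (1, 0)" "\<And>s. (q has_vector_derivative spin_op s (q s)) (at s)"
proof -
  define A where "A s = (1 / 2) *\<^sub>R Blinfun mult_j + (\<kappa>\<^sub>g s / 2) *\<^sub>R Blinfun mult_k" for s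
  have "continuous_on UNIV A"
    unfolding A_def by (intro continuous_intros \<kappa>\<^sub>g_cont) auto
  moreover have "blinfun_apply (A s) x = spin_op s x" for s x
    by (simp add: A_def spin_op_def blinfun.add_left blinfun.scaleR_left bounded_linear_Blinfun_apply
        bounded_linear_mult_j bounded_linear_mult_k)
  ultimately show thesis
    using linear_ode_solution_exists[of A "(1, 0)"] that by metis
qed

text \<open>The system expresses that the vector with these coordinates in the moving frame is at
  rest in space. It is meant for the columns of the rotation matrix of the spinor.\<close>

lemma frame_coordinates_constant:
  assumes p: "\<And>s. (p1 has_real_derivative \<kappa>\<^sub>g s * p2 s - p3 s) (at s)"
    "\<And>s. (p2 has_real_derivative - \<kappa>\<^sub>g s * p1 s) (at s)"
    "\<And>s. (p3 has_real_derivative p1 s) (at s)"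
  shows "p1 s *\<^sub>R T s + p2 s *\<^sub>R N s + p3 s *\<^sub>R \<gamma> s = p1 t *\<^sub>R T t + p2 t *\<^sub>R N t + p3 t *\<^sub>R \<gamma> t"
proof (rule constant_if_zero_derivative)
  fix s
  have T: "(T has_vector_derivative \<kappa>\<^sub>g s *\<^sub>R N s - \<gamma> s) (at s)"
    using T'[of s] by simp
  have "((\<lambda>s. p1 s *\<^sub>R T s + p2 s *\<^sub>R N s + p3 s *\<^sub>R \<gamma> s) has_vector_derivative
      (p1 s *\<^sub>R (\<kappa>\<^sub>g s *\<^sub>R N s - \<gamma> s) + (\<kappa>\<^sub>g s * p2 s - p3 s) *\<^sub>R T s)
      + (p2 s *\<^sub>R (- \<kappa>\<^sub>g s *\<^sub>R T s) + (- \<kappa>\<^sub>g s * p1 s) *\<^sub>R N s) + (p3 s *\<^sub>R T s + p1 s *\<^sub>R \<gamma> s)) (at s)"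
    by (intro has_vector_derivative_add has_vector_derivative_scaleR p T N' \<gamma>')
  then show "((\<lambda>s. p1 s *\<^sub>R T s + p2 s *\<^sub>R N s + p3 s *\<^sub>R \<gamma> s) has_vector_derivative 0) (at s)"
    by (simp add: algebra_simps)
qed

lemma frame_sphere:
  "T s \<bullet> T s = 1" "N s \<bullet> N s = 1" "\<gamma> s \<bullet> \<gamma> s = 1" "T s \<bullet> N s = 0" "T s \<bullet> \<gamma> s = 0" "N s \<bullet> \<gamma> s = 0"
  "cross3 (T s) (N s) = \<gamma> s" "cross3 (N s) (\<gamma> s) = T s" "cross3 (\<gamma> s) (T s) = N s"
proof -
  note [simp] = inner_commute[of "T s" "\<gamma> s"] inner_commute[of "T s" "N s"] inner_commute[of "N s" "\<gamma> s"]
  show *: "T s \<bullet> T s = 1" "N s \<bullet> N s = 1" "\<gamma> s \<bullet> \<gamma> s = 1" "T s \<bullet> N s = 0" "T s \<bullet> \<gamma> s = 0" "N s \<bullet> \<gamma> s = 0"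
    using T_inner[of s] frame(1)[of s] \<nu>_inner[of s] N_T[of s] \<nu>_T[of s] N_\<nu>[of s] by simp_all
  show "cross3 (\<gamma> s) (T s) = N s" by (simp add: N_eq)
  then have N: "N s = cross3 (\<gamma> s) (T s)" by simp
  show "cross3 (T s) (N s) = \<gamma> s"
    unfolding N Lagrange using * by simp
  have "cross3 (N s) (\<gamma> s) = - cross3 (\<gamma> s) (N s)" by (rule cross_skew)
  then show "cross3 (N s) (\<gamma> s) = T s"
    unfolding N Lagrange using * by simp
qed

text \<open>Each column of the conjugation matrix holds the moving coordinates of a fixed vector,
  namely of a frame vector at 0. Hence the entries are the inner products of the frames at s and at
  0. At L the frame has returned, which leaves only q = 1 and q = -1.\<close>

lemma frame_spinor:
  assumes q0: "q 0 = (1, 0)" and q: "\<And>s. (q has_vector_derivative spin_op s (q s)) (at s)"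
  shows "frame_loop L \<gamma> t = quat_rows (T 0) (N 0) (\<gamma> 0) (q (L * t))"
    and "q L = (1, 0) \<or> q L = (-1, 0)"
proof -
  define a b c d where "a s = Re (fst (q s))" and "b s = Im (fst (q s))"
    and "c s = Re (snd (q s))" and "d s = Im (snd (q s))" for s
  note abcd = a_def b_def c_def d_def
  have a': "(a has_real_derivative (- c s - \<kappa>\<^sub>g s * d s) / 2) (at s)"
    and b': "(b has_real_derivative (- d s + \<kappa>\<^sub>g s * c s) / 2) (at s)"
    and c': "(c has_real_derivative (a s - \<kappa>\<^sub>g s * b s) / 2) (at s)"
    and d': "(d has_real_derivative (b s + \<kappa>\<^sub>g s * a s) / 2) (at s)" for s
  proof -
    note Re_fst = bounded_linear_compose[OF bounded_linear_Re bounded_linear_fst]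
    note Im_fst = bounded_linear_compose[OF bounded_linear_Im bounded_linear_fst]
    note Re_snd = bounded_linear_compose[OF bounded_linear_Re bounded_linear_snd]
    note Im_snd = bounded_linear_compose[OF bounded_linear_Im bounded_linear_snd]
    show "(a has_real_derivative (- c s - \<kappa>\<^sub>g s * d s) / 2) (at s)"
      using bounded_linear.has_vector_derivative[OF Re_fst q[of s]]
      unfolding has_real_derivative_iff_has_vector_derivative abcd[abs_def]
      by (rule has_vector_derivative_eq_rhs) (simp add: spin_op_def mult_j_def mult_k_def field_simps)
    show "(b has_real_derivative (- d s + \<kappa>\<^sub>g s * c s) / 2) (at s)"
      using bounded_linear.has_vector_derivative[OF Im_fst q[of s]]
      unfolding has_real_derivative_iff_has_vector_derivative abcd[abs_def]
      by (rule has_vector_derivative_eq_rhs) (simp add: spin_op_def mult_j_def mult_k_def field_simps)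
    show "(c has_real_derivative (a s - \<kappa>\<^sub>g s * b s) / 2) (at s)"
      using bounded_linear.has_vector_derivative[OF Re_snd q[of s]]
      unfolding has_real_derivative_iff_has_vector_derivative abcd[abs_def]
      by (rule has_vector_derivative_eq_rhs) (simp add: spin_op_def mult_j_def mult_k_def field_simps)
    show "(d has_real_derivative (b s + \<kappa>\<^sub>g s * a s) / 2) (at s)"
      using bounded_linear.has_vector_derivative[OF Im_snd q[of s]]
      unfolding has_real_derivative_iff_has_vector_derivative abcd[abs_def]
      by (rule has_vector_derivative_eq_rhs) (simp add: spin_op_def mult_j_def mult_k_def field_simps)
  qed
  have init: "a 0 = 1" "b 0 = 0" "c 0 = 0" "d 0 = 0"
    by (simp_all add: abcd q0)
  note diff_rules = DERIV_add DERIV_diff DERIV_mult DERIV_cmult a' b' c' d'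
  \<comment> \<open>Entries of the conjugation matrix: the row belongs to a frame vector at
    \<open>s\<close>, the column to one at 0.\<close>
  let ?r11 = "\<lambda>s. a s * a s + b s * b s - c s * c s - d s * d s" and ?r12 = "\<lambda>s. 2 * (b s * c s + a s * d s)"
    and ?r13 = "\<lambda>s. 2 * (b s * d s - a s * c s)"
    and ?r21 = "\<lambda>s. 2 * (b s * c s - a s * d s)" and ?r22 = "\<lambda>s. a s * a s - b s * b s + c s * c s - d s * d s"
    and ?r23 = "\<lambda>s. 2 * (c s * d s + a s * b s)"
    and ?r31 = "\<lambda>s. 2 * (b s * d s + a s * c s)" and ?r32 = "\<lambda>s. 2 * (c s * d s - a s * b s)"
    and ?r33 = "\<lambda>s. a s * a s - b s * b s - c s * c s + d s * d s"
  have c1: "?r11 s *\<^sub>R T s + ?r21 s *\<^sub>R N s + ?r31 s *\<^sub>R \<gamma> s = T 0" for s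
  proof -
    have "?r11 s *\<^sub>R T s + ?r21 s *\<^sub>R N s + ?r31 s *\<^sub>R \<gamma> s = ?r11 0 *\<^sub>R T 0 + ?r21 0 *\<^sub>R N 0 + ?r31 0 *\<^sub>R \<gamma> 0"
      by (rule frame_coordinates_constant; rule DERIV_cong, (rule diff_rules)+)
        (simp_all add: field_simps)
    then show ?thesis by (simp add: init)
  qed
  have c2: "?r12 s *\<^sub>R T s + ?r22 s *\<^sub>R N s + ?r32 s *\<^sub>R \<gamma> s = N 0" for s
  proof -
    have "?r12 s *\<^sub>R T s + ?r22 s *\<^sub>R N s + ?r32 s *\<^sub>R \<gamma> s = ?r12 0 *\<^sub>R T 0 + ?r22 0 *\<^sub>R N 0 + ?r32 0 *\<^sub>R \<gamma> 0"
      by (rule frame_coordinates_constant; rule DERIV_cong, (rule diff_rules)+)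
        (simp_all add: field_simps)
    then show ?thesis by (simp add: init)
  qed
  have c3: "?r13 s *\<^sub>R T s + ?r23 s *\<^sub>R N s + ?r33 s *\<^sub>R \<gamma> s = \<gamma> 0" for s
  proof -
    have "?r13 s *\<^sub>R T s + ?r23 s *\<^sub>R N s + ?r33 s *\<^sub>R \<gamma> s = ?r13 0 *\<^sub>R T 0 + ?r23 0 *\<^sub>R N 0 + ?r33 0 *\<^sub>R \<gamma> 0"
      by (rule frame_coordinates_constant; rule DERIV_cong, (rule diff_rules)+)
        (simp_all add: field_simps)
    then show ?thesis by (simp add: init)
  qed
  have coord: "(p1 *\<^sub>R T s + p2 *\<^sub>R N s + p3 *\<^sub>R \<gamma> s) \<bullet> T s = p1"
    "(p1 *\<^sub>R T s + p2 *\<^sub>R N s + p3 *\<^sub>R \<gamma> s) \<bullet> N s = p2"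
    "(p1 *\<^sub>R T s + p2 *\<^sub>R N s + p3 *\<^sub>R \<gamma> s) \<bullet> \<gamma> s = p3" for p1 p2 p3 s
    using frame_sphere(1-6)[of s]
    by (simp_all add: inner_add_left inner_commute[of "N s" "T s"] inner_commute[of "\<gamma> s" "T s"]
        inner_commute[of "\<gamma> s" "N s"])
  note r = coord[of "?r11 s" s "?r21 s" "?r31 s" for s, unfolded c1]
    coord[of "?r12 s" s "?r22 s" "?r32 s" for s, unfolded c2]
    coord[of "?r13 s" s "?r23 s" "?r33 s" for s, unfolded c3]
  have expand: "x = (T 0 \<bullet> x) *\<^sub>R T 0 + (N 0 \<bullet> x) *\<^sub>R N 0 + (\<gamma> 0 \<bullet> x) *\<^sub>R \<gamma> 0" for x
    using frame(3)[of x 0] by (simp add: inner_commute)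
  show "frame_loop L \<gamma> t = quat_rows (T 0) (N 0) (\<gamma> 0) (q (L * t))"
    unfolding frame_loop_def quat_rows_def Let_def abcd[symmetric] power2_eq_square
    by (subst expand[of "T (L * t)"], subst expand[of "N (L * t)"], subst expand[of "\<gamma> (L * t)"])
      (simp only: r)
  have "T L = T 0" "N L = N 0" "\<gamma> L = \<gamma> 0"
    using T_per[of 0] N_per[of 0] \<gamma>_per[of 0] by simp_all
  \<comment> \<open>Two diagonal entries suffice: together with |q| = 1 they eliminate b, c and
    d.\<close>
  then have "?r11 L = 1" "?r22 L = 1"
    using r(1)[of L] r(5)[of L] frame_sphere(1,2)[of 0] by simp_all
  moreover have one: "a L * a L + b L * b L + c L * c L + d L * d L = 1"
    using spin_solution_norm[OF q, of L 0]
    by (simp add: abcd q0 inner_prod_def inner_complex_def algebra_simps)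
  ultimately have "c L * c L + d L * d L = 0" "b L * b L + d L * d L = 0"
    by linarith+
  then have "b L = 0" "c L = 0" "d L = 0"
    by (simp_all add: sum_squares_eq_zero_iff)
  moreover from this one have "a L = 1 \<or> a L = -1"
    by (simp add: square_eq_1_iff)
  ultimately show "q L = (1, 0) \<or> q L = (-1, 0)"
    by (auto simp: abcd prod_eq_iff complex_eq_iff)
qed

text \<open>If q returned to 1 after a period, it would be a loop in the simply connected 3-sphere;
  the covering map would carry its contraction to one of the frame loop, against the spin
  hypothesis. So q L = -1, and uniqueness spreads the sign change to all s.\<close>

lemma spinor_antiperiodic:
  assumes q0: "q 0 = (1, 0)" and q: "\<And>s. (q has_vector_derivative spin_op s (q s)) (at s)"
  shows "q (s + L) = - q s"
proof -
  have norm: "q s \<bullet> q s = 1" for s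
    using spin_solution_norm[OF q, of s 0] by (simp add: q0 inner_prod_def)
  have qL: "q L = (-1, 0)"
  proof (rule ccontr)
    assume "q L \<noteq> (-1, 0)"
    then have qL: "q L = (1, 0)" using frame_spinor(2)[OF q0 q] by blast
    define p where "p t = q (L * t)" for t
    have q_cont: "continuous_on UNIV q"
      using q by (rule has_vector_derivative_imp_continuous_on)
    have "simply_connected (sphere (0 :: complex \<times> complex) 1)"
      by (rule simply_connected_sphere) simp
    moreover have "path p"
      unfolding path_def p_def by (intro continuous_on_compose2[OF q_cont] continuous_intros) auto
    moreover have "path_image p \<subseteq> sphere 0 1"
      using norm by (auto simp: path_image_def p_def norm_eq_1)
    moreover have "pathfinish p = pathstart p"
      by (simp add: pathfinish_def pathstart_def p_def q0 qL)
    moreover have "(1, 0) \<in> sphere (0 :: complex \<times> complex) 1"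
      by (simp add: norm_eq_1 inner_prod_def)
    ultimately have hom: "homotopic_loops (sphere 0 1) p (linepath (1, 0) (1, 0))"
      unfolding simply_connected_eq_contractible_loop_any by blast
    let ?h = "quat_rows (T 0) (N 0) (\<gamma> 0)"
    have "homotopic_loops {Q. rotation_matrix Q} (?h \<circ> p) (?h \<circ> linepath (1, 0) (1, 0))"
      by (rule homotopic_loops_continuous_image[OF hom continuous_on_quat_rows])
        (auto intro!: rotation_matrix_quat_rows frame_sphere simp: norm_eq_1)
    moreover have "?h \<circ> p = frame_loop L \<gamma>"
      by (auto simp: p_def frame_spinor(1)[OF q0 q])
    moreover have "?h \<circ> linepath (1, 0) (1, 0) = linepath (?h (1, 0)) (?h (1, 0))"
      by (simp add: linepath_refl o_def fun_eq_iff)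
    ultimately show False using spin by auto
  qed
  \<comment> \<open>By periodicity of \<open>\<kappa>\<^sub>g\<close> this solves the same linear
    equation, and it vanishes at 0.\<close>
  define y where "y s = q (s + L) + q s" for s
  have "(y has_vector_derivative spin_op s (y s)) (at s)" for s
  proof -
    have "((\<lambda>s. s + L) has_vector_derivative 1) (at s)"
      using has_vector_derivative_add[OF has_vector_derivative_id has_vector_derivative_const[of L]] by simp
    then have "(q \<circ> (\<lambda>s. s + L) has_vector_derivative 1 *\<^sub>R spin_op (s + L) (q (s + L))) (at s)"
      by (rule vector_diff_chain_at) (rule q)
    moreover have "spin_op (s + L) = spin_op s" by (simp add: spin_op_def[abs_def] \<kappa>\<^sub>g_per)
    ultimately have "((\<lambda>s. q (s + L)) has_vector_derivative spin_op s (q (s + L))) (at s)"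
      by (simp add: o_def)
    from has_vector_derivative_add[OF this q] show ?thesis
      by (simp add: y_def[abs_def] linear_simps[OF spin_op_linear])
  qed
  from spin_solution_norm[OF this, of s 0] have "y s = 0"
    by (simp add: y_def q0 qL)
  then show ?thesis by (simp add: y_def eq_neg_iff_add_eq_0)
qed

text \<open>In the equality case the skew map \<open>mult_j\<close> makes u^2 constant, and dividing
  the quantity conserved through \<open>mult_k\<close> by it isolates
  \<open>\<kappa>\<^sub>g\<close>.\<close>

lemma sphere_eigenvalue_bound:
  "4 * pi\<^sup>2 / L\<^sup>2 \<le> \<mu>"
  "4 * pi\<^sup>2 / L\<^sup>2 = \<mu> \<Longrightarrow> curvature Unit_Sphere \<gamma> constant_on UNIV"
proof -
  obtain q where q0: "q 0 = (1, 0)" and q: "\<And>s. (q has_vector_derivative spin_op s (q s)) (at s)"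
    by (rule spin_solution_exists) blast
  have norm: "q s \<bullet> q s = 1" for s
    using spin_solution_norm[OF q, of s 0] by (simp add: q0 inner_prod_def)
  have q_cont: "continuous_on UNIV q"
    using q by (rule has_vector_derivative_imp_continuous_on)
  have "continuous_on UNIV (\<lambda>s. spin_op s (q s))"
    unfolding spin_op_def
    by (intro continuous_intros q_cont \<kappa>\<^sub>g_cont bounded_linear.continuous_on[OF bounded_linear_mult_j]
        bounded_linear.continuous_on[OF bounded_linear_mult_k]) auto
  then interpret spinor_eigenfunction L \<mu> q "\<lambda>s. spin_op s (q s)" "\<lambda>s. (curvature Unit_Sphere \<gamma> s)\<^sup>2" u u' u''
    by unfold_locales
      (use L q u u' u_per u_eq u_nz norm spinor_antiperiodic[OF q0 q] in
        \<open>simp_all add: norm_eq_1 spin_op_norm curvature_squared\<close>)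
  show "4 * pi\<^sup>2 / L\<^sup>2 \<le> \<mu>" by (rule eigenvalue_ge)
  assume extremal: "4 * pi\<^sup>2 / L\<^sup>2 = \<mu>"
  interpret spinor_eigenfunction_extremal L \<mu> q "\<lambda>s. spin_op s (q s)"
    "\<lambda>s. (curvature Unit_Sphere \<gamma> s)\<^sup>2" u u' u''
    by unfold_locales (rule extremal)
  obtain k1 where "\<And>s. (u s)\<^sup>2 * (mult_j (q s) \<bullet> spin_op s (q s)) = k1"
    by (rule conserved_skew[OF bounded_linear.linear[OF bounded_linear_mult_j] mult_j_k_inner(1)]) blast
  then have k1: "(u s)\<^sup>2 / 2 = k1" for s
    by (simp add: spin_op_def inner_add_right mult_j_k_inner norm)
  obtain k2 where "\<And>s. (u s)\<^sup>2 * (mult_k (q s) \<bullet> spin_op s (q s)) = k2"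
    by (rule conserved_skew[OF bounded_linear.linear[OF bounded_linear_mult_k] mult_j_k_inner(2)]) blast
  then have k2: "(u s)\<^sup>2 / 2 * \<kappa>\<^sub>g s = k2" for s
    by (simp add: spin_op_def inner_add_right mult_j_k_inner norm
        inner_commute[of "mult_k x" "mult_j x" for x])
  have "k1 \<noteq> 0" using k1 u_nz by auto
  then have "\<kappa>\<^sub>g s = k2 / k1" for s
    using k2[of s] unfolding k1 by (simp add: eq_divide_eq mult.commute)
  then show "curvature Unit_Sphere \<gamma> constant_on UNIV"
    unfolding curvature_constant_iff by (auto simp: constant_on_def)
qed

end

text \<open>The converse is stated for curves traversed once because a circle covered three times
  also has odd rotation number, while its first eigenvalue \<kappa>^2 is 36 pi^2 / L^2.\<close>

theorem theorem1:
  fixes X :: space_form and \<gamma> :: "real \<Rightarrow> real^3" and L \<mu>\<^sub>1 :: real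
  assumes "closed_arclength_curve L \<gamma>"
    and "lies_on \<gamma> X"
    and "nontrivial_spin_structure X L \<gamma>"
    and "first_eigenvalue L (\<lambda>s. (curvature X \<gamma> s)\<^sup>2) \<mu>\<^sub>1"
  shows "4 * pi\<^sup>2 / L\<^sup>2 \<le> \<mu>\<^sub>1
    \<and> (4 * pi\<^sup>2 / L\<^sup>2 = \<mu>\<^sub>1 \<longrightarrow> curvature X \<gamma> constant_on UNIV)
    \<and> (traversed_once L \<gamma> \<longrightarrow> curvature X \<gamma> constant_on UNIV \<longrightarrow> 4 * pi\<^sup>2 / L\<^sup>2 = \<mu>\<^sub>1)"
proof -
  interpret C: surface_curve L \<gamma> X
    using assms(1,2) by unfold_locales
  have eig: "periodic_eigenvalue L (\<lambda>s. (curvature X \<gamma> s)\<^sup>2) \<mu>\<^sub>1"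
    and least: "\<And>\<nu>. periodic_eigenvalue L (\<lambda>s. (curvature X \<gamma> s)\<^sup>2) \<nu> \<Longrightarrow> \<mu>\<^sub>1 \<le> \<nu>"
    using assms(4) unfolding first_eigenvalue_def by blast+
  obtain u u' u'' where u: "\<And>s. (u has_real_derivative u' s) (at s)"
    "\<And>s. (u' has_real_derivative u'' s) (at s)" "\<And>s. u (s + L) = u s"
    "\<And>s. - 4 * u'' s + (curvature X \<gamma> s)\<^sup>2 * u s = \<mu>\<^sub>1 * u s" "\<exists>s. u s \<noteq> 0"
    using periodic_eigenvalueE[OF eig] by blast
  have "4 * pi\<^sup>2 / L\<^sup>2 \<le> \<mu>\<^sub>1 \<and> (4 * pi\<^sup>2 / L\<^sup>2 = \<mu>\<^sub>1 \<longrightarrow> curvature X \<gamma> constant_on UNIV)"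
  proof (cases X)
    case (Plane n d)
    then obtain e and k :: int where
      e: "norm e = 1" "e \<bullet> n = 0" "odd k" "rotation_number n e L \<gamma> = of_int k"
      using assms(3) by auto
    interpret P: plane_curve_eigenfunction L \<gamma> n d e k \<mu>\<^sub>1 u u' u''
      using assms(1,2) e u unfolding Plane by unfold_locales
    show ?thesis unfolding Plane using P.plane_eigenvalue_bound by blast
  next
    case Unit_Sphere
    interpret S: sphere_curve_eigenfunction L \<gamma> \<mu>\<^sub>1 u u' u''
      using assms(1,2,3) u unfolding Unit_Sphere by unfold_locales
    show ?thesis unfolding Unit_Sphere using S.sphere_eigenvalue_bound by blast
  qed
  moreover have "\<mu>\<^sub>1 \<le> 4 * pi\<^sup>2 / L\<^sup>2"
    if once: "traversed_once L \<gamma>" and const: "curvature X \<gamma> constant_on UNIV"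
  proof -
    obtain k where k: "\<And>s. curvature X \<gamma> s = k"
      using const by (auto simp: constant_on_def)
    \<comment> \<open>The constant function 1 is an eigenfunction with eigenvalue k^2, which bounds
      the least eigenvalue from above.\<close>
    have "\<mu>\<^sub>1 \<le> k\<^sup>2" by (rule least) (simp add: k periodic_eigenvalue_const)
    also have "\<dots> \<le> 4 * pi\<^sup>2 / L\<^sup>2" by (rule C.constant_curvature_le[OF k once])
    finally show ?thesis .
  qed
  ultimately show ?thesis by (meson order.antisym)
qed

end
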